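(* Let $T$ be a self-similar interval exchange map with associated substitution $\sigma$ and matrix $M$. Assume that $M$ has an eigenvalue $\beta$ with $|\beta|>1$ such that $\beta_0=\beta/|\beta|$ is not a root of unity, and that there exists an eigenvector $\Gamma$ of $M$ for $\beta$ such that $T$ has the unique representation property for $\beta$ and $\Gamma$. Let $\gamma=z\Gamma$ be a good eigenvector, let $\tau=z/|z|\in\mathbb S^1$, and suppose that $(\tau,(p_0,c_0,s_0))$ belongs to a minimal component of the map $H$. For $m\ge0$ write $H^{-m}(\tau,(p_0,c_0,s_0))=(\beta_0^m\tau,(p_m,c_m,s_m))$, where $H^{-1}$ is the inverse of the restriction of $H$ to this minimal component. Then $(p_m,c_m,s_m)_{m\ge0}$ is the prefix-suffix decomposition of some shift $S^k(\omega)$, $k\in\mathbb Z$, of a minimal sequence $\omega\in\Omega_\sigma$ for the vector $\gamma$.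
   Context: **Self-similar i.e.m. and substitution.** Let $I=[0,1)$ and $\mathcal A$ a finite alphabet. An interval exchange map (i.e.m.) is a bijection $T\colon I\to I$ such that, for a partition $(I_a)_{a\in\mathcal A}$ of $I$ into (left-closed, right-open) intervals and a vector $\delta\in\mathbb R^{\mathcal A}$, $T(t)=t+\delta_a$ for $t\in I_a$. $T$ is self-similar (on $[0,\alpha)$, $0<\alpha<1$) if its first return map to $[0,\alpha)$ equals $T$ up to rescaling; it exchanges the intervals $I^{(1)}_a=\alpha I_a$, and $r_a$ is the first return time of $I_a^{(1)}$ to $[0,\alpha)$. The associated substitution $\sigma\colon\mathcal A\to\mathcal A^*\setminus\{\varepsilon\}$ ($\mathcal A^*$: finite words, $\varepsilon$: empty word) is given by $\sigma(a)=w_0\dots w_{r_a-1}$ where $T^m(I^{(1)}_a)\subseteq I_{w_m}$ for $0\le m\le r_a-1$ (it is part of the setting that this makes sense). $T$ is minimal and $\sigma$ is primitive. $M$ is the $\mathcal A\times\mathcal A$ matrix with $M_{a,b}$ = number of occurrences of $b$ in $\sigma(a)$. **Subshift, minimal sequences, prefix-suffix decomposition.** $\Omega_\sigma\subseteq\mathcal A^{\mathbb Z}$ is the set of two-sided sequences all of whose finite subwords are subwords of $\sigma^n(a)$ for some $n\ge0$, $a\in\mathcal A$; $S$ is the left shift. For $\gamma\in\mathbb C^{\mathcal A}$ and a word $w=w_0\dots w_{n-1}$ put $\gamma(w)=\gamma_{w_0}+\dots+\gamma_{w_{n-1}}$; for $\omega\in\Omega_\sigma$ put $\gamma_0(\omega)=0$,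 $\gamma_n(\omega)=\gamma(\omega_0\dots\omega_{n-1})$, $\gamma_{-n}(\omega)=-\gamma(\omega_{-n}\dots\omega_{-1})$ for $n\ge1$. $\omega$ is a minimal sequence for $\gamma$ if $\mathrm{Re}(\gamma_n(\omega))\ge0$ for all $n\in\mathbb Z$. The prefix-suffix decomposition of $\omega\in\Omega_\sigma$ is the unique sequence $(p_m,c_m,s_m)_{m\ge0}$ in $\mathcal A^*\times\mathcal A\times\mathcal A^*$ such that for all $m\ge0$, $\sigma(c_{m+1})=p_mc_ms_m$ and $\sigma^m(p_m)\dots\sigma(p_1)p_0\cdot c_0s_0\sigma(s_1)\dots\sigma^m(s_m)$ is the central part of $\omega$ (the dot separates negative and nonnegative coordinates). **Fractals.** Let $\bar{\mathcal A}_a=\{(p,c,s)\in\mathcal A^*\times\mathcal A\times\mathcal A^*:\sigma(a)=pcs\}$ and $\bar{\mathcal A}=\bigcup_a\bar{\mathcal A}_a$ (labels). Let $\mathcal S_a$ be the set of sequences $x=(p^x_m,c^x_m,s^x_m)_{m\ge1}\in\bar{\mathcal A}^{\mathbb N}$ with $(p^x_1,c^x_1,s^x_1)\in\bar{\mathcal A}_a$ and $(p^x_{m+1},c^x_{m+1},s^x_{m+1})\in\bar{\mathcal A}_{c^x_m}$ for $m\ge1$; let $\mathcal S_{a,(p,c,s)}$ be those with first coordinate $(p,c,s)$. Put $z_a(x)=\sum_{m\ge1}\beta^{-m}\Gamma(p^x_m)$, $F_a=z_a(\mathcal S_a)$, $F_{a,(p,c,s)}=z_a(\mathcal S_{a,(p,c,s)})$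 (compact subsets of $\mathbb C$). For $\tau\in\mathbb S^1$ (unit circle in $\mathbb C$) let $v_a(\tau)=\min_{z\in F_a}\mathrm{Re}(\tau z)$ and $v_{a,(p,c,s)}(\tau)=\min_{z\in F_{a,(p,c,s)}}\mathrm{Re}(\tau z)$. A point $z\in F_a$ is extreme for the direction $\tau$ if $\mathrm{Re}(\tau z)=v_a(\tau)$. **Unique representation property (u.r.p.)** for $\beta$ and $\Gamma$: for every $a\in\mathcal A$ and every extreme point $z\in F_a$ (for any direction) there is a unique $x\in\mathcal S_a$ with $z_a(x)=z$. **Good eigenvectors.** $\Psi_a$ is the set of $\tau\in\mathbb S^1$ such that $v_a(\tau)=v_{a,(p,c,s)}(\tau)=v_{a,(\bar p,\bar c,\bar s)}(\tau)$ for some different labels $(p,c,s),(\bar p,\bar c,\bar s)\in\bar{\mathcal A}_a$; $\Psi=\bigcup_a\Psi_a$. $\llbracket\tau-\tau'\rrbracket$ is the natural (arc-length) distance on $\mathbb S^1$. A direction $\tau\in\mathbb S^1$ is good if for some constant $1<A<|\beta|$ and every $\xi\in\Psi$, $\liminf_{n\to\infty}A^n\llbracket\xi-\beta_0^n\tau\rrbracket=\infty$. An eigenvector $\gamma$ of $M$ for $\beta$ is good if $\gamma=z\Gamma$ with $z\in\mathbb C\setminus\{0\}$ and $z/|z|$ a good direction. **The map $H$.** Let $X=\mathbb S^1\times\bar{\mathcal A}$ and $H\colon X\to X$, $H(\tau,(q,a,r))=(\beta_0^{-1}\tau,(p,c,s))$, where $(p,c,s)\in\bar{\mathcal A}_a$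 satisfies $v_a(\tau)=v_{a,(p,c,s)}(\tau)$. Under the u.r.p. the choice of $(p,c,s)$ is ambiguous for only finitely many $\tau$, and there it is made so that $H$ is right-continuous. **Minimal components.** Split $I=[0,1)$ into $|\bar{\mathcal A}|$ consecutive left-closed right-open intervals $I_{(p,c,s)}$ of equal length, one per label, and identify $\mathbb S^1\times\{(p,c,s)\}$ with $I_{(p,c,s)}$ by the orientation-preserving linear bijection sending $1\in\mathbb S^1$ to the left endpoint. Under this identification $H$ becomes a map $H\colon I\to I$ that is a translation on each of finitely many intervals. Let $\tilde H(t)=\lim_{s\nearrow t}H(s)$ be its left-continuous version, $D$ the set of discontinuities of $H$ together with their preimages and images by (iterates of) $\tilde H$, and $\hat I=I\cup\{t^-:t\in D\}\cup\{1\}$, where $t^-$ is a new point placed immediately to the left of $t$, with the order topology (compact metrizable). Let $\hat H\colon\hat I\to\hat I$ be the continuous map with $\hat H=H$ on $I$, $\hat H(t^-)=(\tilde H(t))^-$ for $t\in D$, and $\hat H(1)$ defined by continuity. A minimal component of $\hat H$ is a nonempty closed set $\hat J\subseteq \hat I$ with $\hat H(\hat J)=\hat J$ in which every point has dense $\hat H$-orbit. A minimal component of $H$ is a set $J=\hat J\cap I$ with $\hat J$ a minimal component of $\hat H$ (or the corresponding subset of $X$). Under the present hypotheses $H$ restricts to a bijection of each minimal component. *)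

theory Defs
  imports "HOL-Analysis.Analysis" "HOL-Library.Sublist"
begin

section \<open>Self-similar interval exchange maps\<close>

definition is_iem :: "(real \<Rightarrow> real) \<Rightarrow> ('a::finite \<Rightarrow> real set) \<Rightarrow> real^'a \<Rightarrow> bool" where
  "is_iem T P \<delta> \<longleftrightarrow>
     (\<forall>a. \<exists>l u. l < u \<and> P a = {l..<u}) \<and> disjoint_family P \<and> (\<Union>a. P a) = {0..<1} \<and>
     bij_betw T {0..<1} {0..<1} \<and> (\<forall>a. \<forall>t\<in>P a. T t = t + \<delta> $ a)"

text \<open>Every two-sided orbit is dense in the unit interval.\<close>

definition iem_minimal :: "(real \<Rightarrow> real) \<Rightarrow> bool" where
  "iem_minimal T \<longleftrightarrow>
     (\<forall>t\<in>{0..<1}. {0..<1} \<subseteq> closure {s\<in>{0..<1}. \<exists>n. (T ^^ n) t = s \<or> (T ^^ n) s = t})"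

definition first_return_time :: "(real \<Rightarrow> real) \<Rightarrow> real set \<Rightarrow> real \<Rightarrow> nat" where
  "first_return_time T J t = (LEAST n. 0 < n \<and> (T ^^ n) t \<in> J)"

definition first_return_map :: "(real \<Rightarrow> real) \<Rightarrow> real set \<Rightarrow> real \<Rightarrow> real" where
  "first_return_map T J t = (T ^^ first_return_time T J t) t"

definition self_similar :: "(real \<Rightarrow> real) \<Rightarrow> real \<Rightarrow> bool" where
  "self_similar T \<alpha> \<longleftrightarrow> 0 < \<alpha> \<and> \<alpha> < 1 \<and>
     (\<forall>t\<in>{0..<\<alpha>}. (\<exists>n>0. (T ^^ n) t \<in> {0..<\<alpha>}) \<and>
        first_return_map T {0..<\<alpha>} t = \<alpha> * T (t / \<alpha>))"

text \<open>This determines \<open>\<sigma>\<close>; that such a \<open>\<sigma>\<close> exists says that the return time is constant on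
  each \<open>\<alpha> I\<^sub>a\<close> and that the itinerary of \<open>\<alpha> I\<^sub>a\<close> is well defined.\<close>

definition associated_substitution ::
    "(real \<Rightarrow> real) \<Rightarrow> ('a \<Rightarrow> real set) \<Rightarrow> real \<Rightarrow> ('a \<Rightarrow> 'a list) \<Rightarrow> bool" where
  "associated_substitution T P \<alpha> \<sigma> \<longleftrightarrow>
     (\<forall>a. (\<forall>t\<in>(\<lambda>t. \<alpha> * t) ` P a. first_return_time T {0..<\<alpha>} t = length (\<sigma> a)) \<and>
        (\<forall>m<length (\<sigma> a). (T ^^ m) ` (\<lambda>t. \<alpha> * t) ` P a \<subseteq> P (\<sigma> a ! m)))"

section \<open>Substitutions and their subshifts\<close>

definition subst_word :: "('a \<Rightarrow> 'a list) \<Rightarrow> 'a list \<Rightarrow> 'a list" where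
  "subst_word \<sigma> w = concat (map \<sigma> w)"

definition primitive_subst :: "('a \<Rightarrow> 'a list) \<Rightarrow> bool" where
  "primitive_subst \<sigma> \<longleftrightarrow> (\<exists>n\<ge>1. \<forall>a b. b \<in> set ((subst_word \<sigma> ^^ n) [a]))"

definition subst_matrix :: "('a::finite \<Rightarrow> 'a list) \<Rightarrow> complex^'a^'a" where
  "subst_matrix \<sigma> = (\<chi> a b. of_nat (count_list (\<sigma> a) b))"

definition is_eigenvector :: "complex^'a^'a \<Rightarrow> complex \<Rightarrow> complex^'a::finite \<Rightarrow> bool" where
  "is_eigenvector M \<beta> v \<longleftrightarrow> v \<noteq> 0 \<and> M *v v = \<beta> *s v"

definition subshift :: "('a \<Rightarrow> 'a list) \<Rightarrow> (int \<Rightarrow> 'a) set" where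
  "subshift \<sigma> = {\<omega>. \<forall>i j. \<exists>n a. sublist (map \<omega> [i..j]) ((subst_word \<sigma> ^^ n) [a])}"

definition shift :: "int \<Rightarrow> (int \<Rightarrow> 'a) \<Rightarrow> int \<Rightarrow> 'a" where
  "shift k \<omega> = (\<lambda>n. \<omega> (n + k))"

definition word_value :: "complex^'a::finite \<Rightarrow> 'a list \<Rightarrow> complex" where
  "word_value \<gamma> w = sum_list (map (\<lambda>a. \<gamma> $ a) w)"

definition cocycle :: "complex^'a::finite \<Rightarrow> (int \<Rightarrow> 'a) \<Rightarrow> int \<Rightarrow> complex" where
  "cocycle \<gamma> \<omega> n =
     (if n \<ge> 0 then word_value \<gamma> (map \<omega> [0..n - 1]) else - word_value \<gamma> (map \<omega> [n..-1]))"

definition minimal_sequence :: "complex^'a::finite \<Rightarrow> (int \<Rightarrow> 'a) \<Rightarrow> bool" where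
  "minimal_sequence \<gamma> \<omega> \<longleftrightarrow> (\<forall>n. Re (cocycle \<gamma> \<omega> n) \<ge> 0)"

type_synonym 'a label = "'a list \<times> 'a \<times> 'a list"

abbreviation prefix_of :: "'a label \<Rightarrow> 'a list" where "prefix_of l \<equiv> fst l"
abbreviation letter_of :: "'a label \<Rightarrow> 'a" where "letter_of l \<equiv> fst (snd l)"
abbreviation suffix_of :: "'a label \<Rightarrow> 'a list" where "suffix_of l \<equiv> snd (snd l)"

text \<open>\<open>L\<close> is \<open>\<sigma>\<^sup>m(p\<^sub>m) \<dots> \<sigma>(p\<^sub>1) p\<^sub>0\<close> and \<open>R\<close> is \<open>c\<^sub>0 s\<^sub>0 \<sigma>(s\<^sub>1) \<dots> \<sigma>\<^sup>m(s\<^sub>m)\<close>; \<open>L\<close> ends at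
  coordinate -1 and \<open>R\<close> begins at coordinate 0.\<close>

definition prefix_suffix_decomposition ::
    "('a \<Rightarrow> 'a list) \<Rightarrow> (int \<Rightarrow> 'a) \<Rightarrow> (nat \<Rightarrow> 'a label) \<Rightarrow> bool" where
  "prefix_suffix_decomposition \<sigma> \<omega> d \<longleftrightarrow>
     (\<forall>m. \<sigma> (letter_of (d (Suc m))) = prefix_of (d m) @ letter_of (d m) # suffix_of (d m) \<and>
        (let L = concat (map (\<lambda>i. (subst_word \<sigma> ^^ i) (prefix_of (d i))) (rev [0..<Suc m]));
             R = letter_of (d 0) # concat (map (\<lambda>i. (subst_word \<sigma> ^^ i) (suffix_of (d i))) [0..<Suc m])
         in map \<omega> [- int (length L)..int (length R) - 1] = L @ R))"

section \<open>Fractals, extreme points and good directions\<close>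

definition labels_at :: "('a \<Rightarrow> 'a list) \<Rightarrow> 'a \<Rightarrow> 'a label set" where
  "labels_at \<sigma> a = {(p, c, s). \<sigma> a = p @ c # s}"

definition labels :: "('a \<Rightarrow> 'a list) \<Rightarrow> 'a label set" where
  "labels \<sigma> = (\<Union>a. labels_at \<sigma> a)"

text \<open>Sequences are indexed from 0 here, so \<open>x m\<close> is the coordinate of index \<open>m + 1\<close>.\<close>

definition label_seqs :: "('a \<Rightarrow> 'a list) \<Rightarrow> 'a \<Rightarrow> (nat \<Rightarrow> 'a label) set" where
  "label_seqs \<sigma> a =
     {x. x 0 \<in> labels_at \<sigma> a \<and> (\<forall>m. x (Suc m) \<in> labels_at \<sigma> (letter_of (x m)))}"

definition label_seqs_from :: "('a \<Rightarrow> 'a list) \<Rightarrow> 'a \<Rightarrow> 'a label \<Rightarrow> (nat \<Rightarrow> 'a label) set" where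
  "label_seqs_from \<sigma> a l = {x \<in> label_seqs \<sigma> a. x 0 = l}"

definition represented :: "complex \<Rightarrow> complex^'a::finite \<Rightarrow> (nat \<Rightarrow> 'a label) \<Rightarrow> complex" where
  "represented \<beta> \<Gamma> x = (\<Sum>m. word_value \<Gamma> (prefix_of (x m)) / \<beta> ^ Suc m)"

definition fractal ::
    "('a::finite \<Rightarrow> 'a list) \<Rightarrow> complex \<Rightarrow> complex^'a \<Rightarrow> 'a \<Rightarrow> complex set" where
  "fractal \<sigma> \<beta> \<Gamma> a = represented \<beta> \<Gamma> ` label_seqs \<sigma> a"

definition subfractal ::
    "('a::finite \<Rightarrow> 'a list) \<Rightarrow> complex \<Rightarrow> complex^'a \<Rightarrow> 'a \<Rightarrow> 'a label \<Rightarrow> complex set" where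
  "subfractal \<sigma> \<beta> \<Gamma> a l = represented \<beta> \<Gamma> ` label_seqs_from \<sigma> a l"

text \<open>The fractals are nonempty and compact, so the infimum is a minimum.\<close>

definition min_re :: "complex set \<Rightarrow> complex \<Rightarrow> real" where
  "min_re F \<tau> = (INF z\<in>F. Re (\<tau> * z))"

definition unique_representation ::
    "('a::finite \<Rightarrow> 'a list) \<Rightarrow> complex \<Rightarrow> complex^'a \<Rightarrow> bool" where
  "unique_representation \<sigma> \<beta> \<Gamma> \<longleftrightarrow>
     (\<forall>a. \<forall>z\<in>fractal \<sigma> \<beta> \<Gamma> a.
        (\<exists>\<tau>\<in>sphere 0 1. Re (\<tau> * z) = min_re (fractal \<sigma> \<beta> \<Gamma> a) \<tau>) \<longrightarrow>
        (\<exists>!x. x \<in> label_seqs \<sigma> a \<and> represented \<beta> \<Gamma> x = z))"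

definition ambiguous_directions_at ::
    "('a::finite \<Rightarrow> 'a list) \<Rightarrow> complex \<Rightarrow> complex^'a \<Rightarrow> 'a \<Rightarrow> complex set" where
  "ambiguous_directions_at \<sigma> \<beta> \<Gamma> a =
     {\<tau> \<in> sphere 0 1. \<exists>l\<in>labels_at \<sigma> a. \<exists>l'\<in>labels_at \<sigma> a. l \<noteq> l' \<and>
        min_re (fractal \<sigma> \<beta> \<Gamma> a) \<tau> = min_re (subfractal \<sigma> \<beta> \<Gamma> a l) \<tau> \<and>
        min_re (fractal \<sigma> \<beta> \<Gamma> a) \<tau> = min_re (subfractal \<sigma> \<beta> \<Gamma> a l') \<tau>}"

definition ambiguous_directions ::
    "('a::finite \<Rightarrow> 'a list) \<Rightarrow> complex \<Rightarrow> complex^'a \<Rightarrow> complex set" where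
  "ambiguous_directions \<sigma> \<beta> \<Gamma> = (\<Union>a. ambiguous_directions_at \<sigma> \<beta> \<Gamma> a)"

text \<open>Arc length on the unit circle; \<open>Arg\<close> takes values in \<open>{-\<pi><..\<pi>}\<close>.\<close>

definition arc_dist :: "complex \<Rightarrow> complex \<Rightarrow> real" where
  "arc_dist \<xi> \<tau> = \<bar>Arg (\<xi> / \<tau>)\<bar>"

definition good_direction ::
    "('a::finite \<Rightarrow> 'a list) \<Rightarrow> complex \<Rightarrow> complex^'a \<Rightarrow> complex \<Rightarrow> bool" where
  "good_direction \<sigma> \<beta> \<Gamma> \<tau> \<longleftrightarrow> \<tau> \<in> sphere 0 1 \<and>
     (\<exists>A. 1 < A \<and> A < cmod \<beta> \<and>
        (\<forall>\<xi>\<in>ambiguous_directions \<sigma> \<beta> \<Gamma>.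
           liminf (\<lambda>n. ereal (A ^ n * arc_dist \<xi> (sgn \<beta> ^ n * \<tau>))) = \<infinity>))"

definition good_eigenvector ::
    "('a::finite \<Rightarrow> 'a list) \<Rightarrow> complex \<Rightarrow> complex^'a \<Rightarrow> complex^'a \<Rightarrow> bool" where
  "good_eigenvector \<sigma> \<beta> \<Gamma> \<gamma> \<longleftrightarrow> is_eigenvector (subst_matrix \<sigma>) \<beta> \<gamma> \<and>
     (\<exists>z. z \<noteq> 0 \<and> \<gamma> = z *s \<Gamma> \<and> good_direction \<sigma> \<beta> \<Gamma> (sgn z))"

section \<open>The map H\<close>

definition states :: "('a \<Rightarrow> 'a list) \<Rightarrow> (complex \<times> 'a label) set" where
  "states \<sigma> = sphere 0 1 \<times> labels \<sigma>"

text \<open>Right-continuity refers to the counterclockwise orientation of the circle. The labels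
  are discrete and the first component is a rotation, so only the label matters.\<close>

definition is_H_map ::
    "('a::finite \<Rightarrow> 'a list) \<Rightarrow> complex \<Rightarrow> complex^'a \<Rightarrow>
     (complex \<times> 'a label \<Rightarrow> complex \<times> 'a label) \<Rightarrow> bool" where
  "is_H_map \<sigma> \<beta> \<Gamma> H \<longleftrightarrow>
     (\<forall>\<tau> q a r. (\<tau>, (q, a, r)) \<in> states \<sigma> \<longrightarrow>
        (\<exists>l\<in>labels_at \<sigma> a.
           min_re (fractal \<sigma> \<beta> \<Gamma> a) \<tau> = min_re (subfractal \<sigma> \<beta> \<Gamma> a l) \<tau> \<and>
           H (\<tau>, (q, a, r)) = (inverse (sgn \<beta>) * \<tau>, l)) \<and>
        (\<forall>\<^sub>F \<theta> in at_right 0.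
           snd (H (\<tau> * cis \<theta>, (q, a, r))) = snd (H (\<tau>, (q, a, r)))))"

section \<open>Minimal components\<close>

text \<open>An enumeration \<open>e\<close> of the labels fixes the order of the consecutive intervals; the
  circle of label \<open>l\<close> is laid out on the interval number \<open>e l\<close>.\<close>

definition to_interval ::
    "('a \<Rightarrow> 'a list) \<Rightarrow> ('a label \<Rightarrow> nat) \<Rightarrow> complex \<times> 'a label \<Rightarrow> real" where
  "to_interval \<sigma> e x =
     (real (e (snd x)) + Arg2pi (fst x) / (2 * pi)) / real (card (labels \<sigma>))"

definition interval_map ::
    "('a \<Rightarrow> 'a list) \<Rightarrow> ('a label \<Rightarrow> nat) \<Rightarrow>
     (complex \<times> 'a label \<Rightarrow> complex \<times> 'a label) \<Rightarrow> real \<Rightarrow> real" where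
  "interval_map \<sigma> e H t = to_interval \<sigma> e (H (the_inv_into (states \<sigma>) (to_interval \<sigma> e) t))"

definition left_version :: "(real \<Rightarrow> real) \<Rightarrow> real \<Rightarrow> real" where
  "left_version h t = Lim (at_left t) h"

text \<open>The set \<open>D\<close>: the discontinuities of \<open>h\<close>, closed under images and preimages by the
  left-continuous version, which lives on \<open>{0<..1}\<close>. Closing under both is what makes the
  extension of \<open>h\<close> below continuous.\<close>

inductive_set cut_points :: "(real \<Rightarrow> real) \<Rightarrow> real set" for h where
  discontinuity: "t \<in> {0..<1} \<Longrightarrow> \<not> continuous (at t within {0..<1}) h \<Longrightarrow> t \<in> cut_points h"
| image: "t \<in> cut_points h \<Longrightarrow> left_version h t \<in> cut_points h"
| preimage: "t \<in> {0<..1} \<Longrightarrow> left_version h t \<in> cut_points h \<Longrightarrow> t \<in> cut_points h"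

text \<open>\<open>LeftOf t\<close> is the new point \<open>t\<^sup>-\<close>. The endpoint 1 of the split interval is \<open>LeftOf 1\<close>,
  as it has no right neighbours.\<close>

datatype split_point = LeftOf real | At real

fun split_less :: "split_point \<Rightarrow> split_point \<Rightarrow> bool" where
  "split_less (LeftOf s) (LeftOf t) \<longleftrightarrow> s < t"
| "split_less (LeftOf s) (At t) \<longleftrightarrow> s \<le> t"
| "split_less (At s) (LeftOf t) \<longleftrightarrow> s < t"
| "split_less (At s) (At t) \<longleftrightarrow> s < t"

definition split_interval :: "(real \<Rightarrow> real) \<Rightarrow> split_point set" where
  "split_interval h = At ` {0..<1} \<union> LeftOf ` (cut_points h \<union> {1})"

definition split_topology :: "(real \<Rightarrow> real) \<Rightarrow> split_point topology" where
  "split_topology h = topology_generated_by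
     ({split_interval h} \<union>
      (\<lambda>y. {x \<in> split_interval h. split_less x y}) ` split_interval h \<union>
      (\<lambda>y. {x \<in> split_interval h. split_less y x}) ` split_interval h)"

text \<open>If \<open>t\<close> is a cut point then so is \<open>left_version h t\<close>; the case distinction only concerns
  \<open>LeftOf 1\<close>, whose image is the limit of \<open>h s\<close> as \<open>s\<close> increases to 1.\<close>

fun split_map :: "(real \<Rightarrow> real) \<Rightarrow> split_point \<Rightarrow> split_point" where
  "split_map h (At t) = At (h t)"
| "split_map h (LeftOf t) =
     (if left_version h t \<in> cut_points h \<union> {1} then LeftOf (left_version h t)
      else At (left_version h t))"

definition split_minimal_component :: "(real \<Rightarrow> real) \<Rightarrow> split_point set \<Rightarrow> bool" where
  "split_minimal_component h K \<longleftrightarrow>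
     K \<noteq> {} \<and> closedin (split_topology h) K \<and> split_map h ` K = K \<and>
     (\<forall>x\<in>K. K \<subseteq> split_topology h closure_of (range (\<lambda>n. (split_map h ^^ n) x)))"

definition minimal_component ::
    "('a \<Rightarrow> 'a list) \<Rightarrow> ('a label \<Rightarrow> nat) \<Rightarrow>
     (complex \<times> 'a label \<Rightarrow> complex \<times> 'a label) \<Rightarrow> (complex \<times> 'a label) set \<Rightarrow> bool" where
  "minimal_component \<sigma> e H J \<longleftrightarrow>
     (\<exists>K. split_minimal_component (interval_map \<sigma> e H) K \<and>
        J = {x \<in> states \<sigma>. At (to_interval \<sigma> e x) \<in> K})"

end

theory Submission
  imports Defs "HOL-Analysis.Kronecker_Approximation_Theorem" "HOL-Library.Diagonal_Subsequence"
begin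

text \<open>Write \<open>v\<^sub>a\<close> for the support function of the fractal of the letter \<open>a\<close>, \<open>v\<^sub>a\<^sub>,\<^sub>l\<close> for that
  of the subfractal of a label \<open>l\<close>, \<open>\<beta>\<^sub>0\<close> for \<open>sgn \<beta>\<close>, \<open>\<tau>\<^sub>m\<close> for \<open>\<beta>\<^sub>0\<^sup>m \<tau>\<close> and \<open>\<Gamma>(w)\<close> for the
  value of the word \<open>w\<close>. Since \<open>\<Gamma>(\<sigma>(w)) = \<beta> \<Gamma>(w)\<close>, the subfractal of \<open>l = (p, c, s)\<close> is \<open>(\<Gamma>(p) +
  F\<^sub>c) / \<beta>\<close>, whence the recursion \<open>\<bar>\<beta>\<bar> v\<^sub>a\<^sub>,\<^sub>l(\<beta>\<^sub>0 t) = Re(t \<Gamma>(p)) + v\<^sub>c(t)\<close>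
  (\<open>support_recursion\<close>). Iterating it along \<open>\<sigma>\<^sup>n(a)\<close> bounds \<open>Re(\<tau> \<Gamma>(u)) + v\<^sub>b(\<tau>)\<close> from below by
  \<open>\<bar>\<beta>\<bar>\<^sup>n v\<^sub>a(\<tau>\<^sub>n)\<close> for every prefix \<open>u\<close> of \<open>\<sigma>\<^sup>n(a)\<close> followed by the letter \<open>b\<close>, with equality for
  prefixes that pass through optimal labels only. The map \<open>H\<close> picks optimal labels, so the centre
  of the two-sided sequence built from the labels \<open>l\<^sub>m = (p\<^sub>m, c\<^sub>m, s\<^sub>m)\<close> along the inverse orbit
  is such a prefix at every level: its cocycle is bounded below.

  Boundedness alone does not give a minimum. A position that leaves the central block at level
  \<open>m\<close> uses a label \<open>l \<noteq> l\<^sub>m\<close> there and costs at least \<open>\<bar>\<beta>\<bar>\<^sup>m\<^sup>+\<^sup>1\<close> times the gap between \<open>v\<^sub>a\<^sub>,\<^sub>l\<close>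
  and \<open>v\<^sub>a\<close> at \<open>\<tau>\<^sub>m\<^sub>+\<^sub>1\<close>, where \<open>a = c\<^sub>m\<^sub>+\<^sub>1\<close>. By the unique representation property the two
  subfractals have no common extreme point, so the graphs of their support functions cross
  transversally: near an ambiguous direction \<open>\<xi>\<close> the gap is at least a constant times the
  distance to \<open>\<xi>\<close> (\<open>support_gap_linear\<close>). For a good direction and large \<open>m\<close> this distance is at
  least \<open>A\<^sup>-\<^sup>m\<^sup>-\<^sup>1\<close> with \<open>A < \<bar>\<beta>\<bar>\<close>, so the cost tends to infinity (\<open>good_direction_gap\<close>). Hence
  the cocycle is nonnegative outside a finite window and attains its minimum; the sequence
  shifted to the minimum is minimal.

  The central blocks must exhaust both ends of the line, that is, infinitely many prefixes and
  infinitely many suffixes are nonempty. If the prefixes (or suffixes) were eventually empty, the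
  letters \<open>c\<^sub>m\<close> would eventually be the one whose interval (or whose image under \<open>T\<close>) contains 0,
  because multiplication by \<open>\<alpha>\<close> contracts towards 0. The labels would be eventually constant, and
  density of the orbit of \<open>\<tau>\<close> would shrink the fractal of that letter to a point, which the
  unique representation property forbids (\<open>not_eventually_constant\<close>).

  Finally, the inverse orbit exists because \<open>H\<close> is bijective on a minimal component \<open>J\<close>
  (\<open>H_bij_betw_minimal_component\<close>). Let \<open>N(x)\<close> be the number of points of \<open>J\<close> above the direction
  \<open>x\<close>. As \<open>H\<close> maps \<open>J\<close> onto \<open>J\<close> over the rotation by \<open>\<beta>\<^sub>0\<^sup>-\<^sup>1\<close>, \<open>N\<close> does not increase along
  orbits; as \<open>J\<close> is closed under limits from the right, \<open>N(x)\<close> is at least the number of points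
  above each direction slightly to the right of \<open>x\<close>. Orbits of an irrational rotation are dense
  from the right, so \<open>N\<close> is constant, and a surjection between finite fibres of equal size is
  injective.\<close>

section \<open>Substituted words and their values\<close>

lemma subst_word_simps [simp]:
  "subst_word \<sigma> [] = []" "subst_word \<sigma> (a # w) = \<sigma> a @ subst_word \<sigma> w"
  "subst_word \<sigma> (u @ v) = subst_word \<sigma> u @ subst_word \<sigma> v"
  by (simp_all add: subst_word_def)

lemma subst_word_pow_append:
  "(subst_word \<sigma> ^^ n) (u @ v) = (subst_word \<sigma> ^^ n) u @ (subst_word \<sigma> ^^ n) v"
  by (induction n) auto

lemma subst_word_pow_Nil [simp]: "(subst_word \<sigma> ^^ n) [] = []"
  by (induction n) auto

lemma word_value_simps [simp]:
  "word_value \<gamma> [] = 0" "word_value \<gamma> (a # w) = \<gamma> $ a + word_value \<gamma> w"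
  "word_value \<gamma> (u @ v) = word_value \<gamma> u + word_value \<gamma> v"
  by (simp_all add: word_value_def)

lemma word_value_scale: "word_value (z *s \<gamma>) w = z * word_value \<gamma> w"
  by (induction w) (auto simp: distrib_left)

lemma word_value_eq_sum: "word_value \<gamma> w = (\<Sum>a\<in>UNIV. of_nat (count_list w a) * \<gamma> $ a)"
proof (induction w)
  case (Cons b w)
  have "(\<Sum>a\<in>UNIV. of_nat (count_list (b # w) a) * \<gamma> $ a) =
      (\<Sum>a\<in>UNIV. (if a = b then \<gamma> $ a else 0) + of_nat (count_list w a) * \<gamma> $ a)"
    by (intro sum.cong) (auto simp: distrib_right)
  then show ?case using Cons by (simp add: sum.distrib)
qed simp

lemma eigenvector_word_value:
  assumes "is_eigenvector (subst_matrix \<sigma>) \<beta> \<Gamma>"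
  shows "word_value \<Gamma> (\<sigma> a) = \<beta> * \<Gamma> $ a"
proof -
  have "(subst_matrix \<sigma> *v \<Gamma>) $ a = (\<beta> *s \<Gamma>) $ a" using assms by (simp add: is_eigenvector_def)
  then show ?thesis by (simp add: word_value_eq_sum matrix_vector_mult_def subst_matrix_def)
qed

text \<open>An occurrence of a letter in \<open>\<sigma>(w)\<close> lies in the image of exactly one letter of \<open>w\<close>; this is
  what turns positions in \<open>\<sigma>\<^sup>n(a)\<close> into sequences of labels.\<close>

lemma subst_word_split_at_letter:
  assumes "subst_word \<sigma> w = u @ c # v"
  obtains w1 b w2 p s where "w = w1 @ b # w2" "\<sigma> b = p @ c # s"
    "u = subst_word \<sigma> w1 @ p" "v = s @ subst_word \<sigma> w2"
  using assms
proof (induction w arbitrary: u thesis)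
  case Nil
  then show ?case by simp
next
  case (Cons a w)
  have "\<sigma> a @ subst_word \<sigma> w = u @ c # v" using Cons.prems by simp
  then consider t where "u = \<sigma> a @ t" "subst_word \<sigma> w = t @ c # v"
    | t where "\<sigma> a = u @ t" "t @ subst_word \<sigma> w = c # v"
    by (auto simp: append_eq_append_conv2)
  then show ?case
  proof cases
    case 1
    show ?thesis
    proof (rule Cons.IH[OF _ 1(2)])
      fix w1 b w2 p s
      assume "w = w1 @ b # w2" "\<sigma> b = p @ c # s" "t = subst_word \<sigma> w1 @ p" "v = s @ subst_word \<sigma> w2"
      then show thesis using 1 by (intro Cons.prems(1)[of "a # w1" b w2 p s]) auto
    qed
  next
    case 2
    show ?thesis
    proof (cases t)
      case Nil
      with 2 have "subst_word \<sigma> w = [] @ c # v" by simp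
      then show ?thesis
      proof (rule Cons.IH[rotated])
        fix w1 b w2 p s
        assume "w = w1 @ b # w2" "\<sigma> b = p @ c # s" "[] = subst_word \<sigma> w1 @ p"
          "v = s @ subst_word \<sigma> w2"
        then show thesis using 2 Nil by (intro Cons.prems(1)[of "a # w1" b w2 p s]) auto
      qed
    next
      case (Cons c' s)
      then show ?thesis using 2 Cons.prems(1)[of "[]" a w u s] by auto
    qed
  qed
qed

text \<open>The power \<open>\<sigma>\<^sup>k\<close> is itself a substitution, so the splitting applies to it.\<close>

lemma subst_word_pow_split_at_letter:
  assumes "(subst_word \<sigma> ^^ k) w = u @ b # v"
  obtains p c s u' v' where "w = p @ c # s" "(subst_word \<sigma> ^^ k) [c] = u' @ b # v'"
    "u = (subst_word \<sigma> ^^ k) p @ u'"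
proof -
  have eq: "subst_word (\<lambda>a. (subst_word \<sigma> ^^ k) [a]) w = (subst_word \<sigma> ^^ k) w" for w
  proof (induction w)
    case (Cons a w)
    then show ?case using subst_word_pow_append[where u = "[a]" and v = w] by simp
  qed simp
  have "subst_word (\<lambda>a. (subst_word \<sigma> ^^ k) [a]) w = u @ b # v" by (simp add: eq assms)
  then obtain p c s u' v' where "w = p @ c # s" "(subst_word \<sigma> ^^ k) [c] = u' @ b # v'"
    "u = subst_word (\<lambda>a. (subst_word \<sigma> ^^ k) [a]) p @ u'" by (rule subst_word_split_at_letter)
  then show thesis unfolding eq by (rule that)
qed

section \<open>Label sequences\<close>

lemma labels_at_iff: "l \<in> labels_at \<sigma> a \<longleftrightarrow> \<sigma> a = prefix_of l @ letter_of l # suffix_of l"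
  by (cases l) (auto simp: labels_at_def)

lemma finite_labels_at: "finite (labels_at \<sigma> a)"
proof (rule finite_subset)
  show "labels_at \<sigma> a \<subseteq> (\<lambda>i. (take i (\<sigma> a), \<sigma> a ! i, drop (Suc i) (\<sigma> a))) ` {..<length (\<sigma> a)}"
  proof
    fix l assume "l \<in> labels_at \<sigma> a"
    then have "\<sigma> a = prefix_of l @ letter_of l # suffix_of l" by (simp add: labels_at_iff)
    then show "l \<in> (\<lambda>i. (take i (\<sigma> a), \<sigma> a ! i, drop (Suc i) (\<sigma> a))) ` {..<length (\<sigma> a)}"
      by (intro image_eqI[of _ _ "length (prefix_of l)"]) (auto simp: prod_eq_iff)
  qed
qed simp

lemma finite_labels: "finite (labels (\<sigma> :: 'a::finite \<Rightarrow> 'a list))"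
  by (simp add: labels_def finite_labels_at)

lemma labels_at_subset: "labels_at \<sigma> a \<subseteq> labels \<sigma>"
  by (auto simp: labels_def)

text \<open>The graph-directed structure behind the self-similarity of the fractals.\<close>

lemma label_seqs_Cons:
  "x \<in> label_seqs_from \<sigma> a l \<longleftrightarrow>
     l \<in> labels_at \<sigma> a \<and> x 0 = l \<and> (\<lambda>m. x (Suc m)) \<in> label_seqs \<sigma> (letter_of l)"
  (is "?L \<longleftrightarrow> ?R")
proof
  assume ?L
  then show ?R unfolding label_seqs_from_def label_seqs_def by auto
next
  assume R: ?R
  have "x (Suc m) \<in> labels_at \<sigma> (letter_of (x m))" for m
    using R by (cases m) (auto simp: label_seqs_def)
  then show ?L using R unfolding label_seqs_from_def label_seqs_def by auto
qed

lemma label_seqs_nth: "x \<in> label_seqs \<sigma> a \<Longrightarrow> x m \<in> labels \<sigma>"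
  using labels_at_subset[of \<sigma>] by (cases m) (auto simp: label_seqs_def)

text \<open>Only finitely many labels exist, so a diagonal argument yields coordinatewise limits, and
  the conditions that define label sequences involve two consecutive coordinates at a time.\<close>

lemma label_seqs_seq_compact:
  fixes \<sigma> :: "'a::finite \<Rightarrow> 'a list" and X :: "nat \<Rightarrow> nat \<Rightarrow> 'a label"
  assumes X: "\<And>k. X k \<in> label_seqs_from \<sigma> a l"
  obtains r x where "strict_mono r" "x \<in> label_seqs_from \<sigma> a l"
    "\<And>n. \<forall>\<^sub>F k in sequentially. X (r k) n = x n"
proof -
  have Xl: "X k n \<in> labels \<sigma>" for k n
    using X[of k] label_seqs_nth[of "X k" \<sigma> a n] by (simp add: label_seqs_from_def)
  interpret S: subseqs "\<lambda>n s. \<exists>c. \<forall>k. X (s k) n = c"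
  proof
    fix n and s :: "nat \<Rightarrow> nat" assume "strict_mono s"
    have "(\<lambda>k. X (s k) n) ` UNIV \<subseteq> labels \<sigma>" using Xl by auto
    then have "finite ((\<lambda>k. X (s k) n) ` UNIV)" using finite_labels finite_subset by blast
    then obtain k0 where "infinite {k \<in> UNIV. X (s k) n = X (s k0) n}"
      using pigeonhole_infinite[of UNIV "\<lambda>k. X (s k) n"] by auto
    then obtain r where r: "strict_mono (r :: nat \<Rightarrow> nat)"
      "\<forall>k. r k \<in> {k \<in> UNIV. X (s k) n = X (s k0) n}"
      using infinite_enumerate by blast
    have "\<forall>k. X ((s \<circ> r) k) n = X (s k0) n" using r(2) by simp
    then have "\<exists>c. \<forall>k. X ((s \<circ> r) k) n = c" by (rule exI[of _ "X (s k0) n"])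
    with r(1) show "\<exists>r'::nat \<Rightarrow> nat. strict_mono r' \<and> (\<exists>c. \<forall>k. X ((s \<circ> r') k) n = c)"
      by blast
  qed
  have "\<exists>c. \<forall>k. X ((S.diagseq \<circ> (+) (Suc n)) k) n = c" for n
    by (rule S.diagseq_holds) auto
  then have "\<forall>n. \<exists>c. \<forall>k. X (S.diagseq (Suc n + k)) n = c" by (simp add: o_def)
  then obtain x where "\<forall>n k. X (S.diagseq (Suc n + k)) n = x n" by (rule choice[THEN exE])
  then have x: "\<And>n k. X (S.diagseq (Suc n + k)) n = x n" by blast
  have ev: "\<forall>\<^sub>F k in sequentially. X (S.diagseq k) n = x n" for n
    unfolding eventually_sequentially
  proof (intro exI allI impI)
    fix k assume "Suc n \<le> k"
    then show "X (S.diagseq k) n = x n" using x[of n "k - Suc n"] by simp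
  qed
  have rel: "P (x m) (x n)" if "\<And>k. P (X k m) (X k n)" for P m n
  proof -
    obtain k where "X (S.diagseq k) m = x m" "X (S.diagseq k) n = x n"
      using eventually_happens[OF eventually_conj[OF ev ev, of m n]] by auto
    then show ?thesis using that[of "S.diagseq k"] by simp
  qed
  have "x \<in> label_seqs_from \<sigma> a l"
    unfolding label_seqs_from_def label_seqs_def
  proof (intro CollectI conjI allI)
    show "x 0 \<in> labels_at \<sigma> a"
      by (rule rel) (use X X[of 0] in \<open>auto simp: label_seqs_from_def label_seqs_def\<close>)
    show "x 0 = l" by (rule rel) (use X X[of 0] in \<open>auto simp: label_seqs_from_def label_seqs_def\<close>)
    fix m
    show "x (Suc m) \<in> labels_at \<sigma> (letter_of (x m))"
      by (rule rel[of "\<lambda>p q. p \<in> labels_at \<sigma> (letter_of q)"])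
         (use X X[of 0] in \<open>auto simp: label_seqs_from_def label_seqs_def\<close>)
  qed
  then show thesis using that[OF S.subseq_diagseq] ev by blast
qed

section \<open>Support functions of compact plane sets\<close>

lemma bdd_below_Re_mult:
  assumes "compact F"
  shows "bdd_below ((\<lambda>z. Re (\<tau> * z)) ` F)"
proof -
  have "compact ((\<lambda>z. Re (\<tau> * z)) ` F)"
    by (intro compact_continuous_image continuous_intros assms)
  then show ?thesis by (meson bounded_imp_bdd_below compact_imp_bounded)
qed

lemma min_re_le: "compact F \<Longrightarrow> z \<in> F \<Longrightarrow> min_re F \<tau> \<le> Re (\<tau> * z)"
  unfolding min_re_def by (rule cINF_lower[OF bdd_below_Re_mult])

lemma min_re_attained:
  assumes "compact F" "F \<noteq> {}"
  obtains z where "z \<in> F" "Re (\<tau> * z) = min_re F \<tau>"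
proof -
  have "continuous_on F (\<lambda>z. Re (\<tau> * z))" by (intro continuous_intros)
  then obtain z where z: "z \<in> F" "\<forall>y\<in>F. Re (\<tau> * z) \<le> Re (\<tau> * y)"
    using continuous_attains_inf[OF assms] by blast
  then have "Re (\<tau> * z) \<le> min_re F \<tau>" unfolding min_re_def using assms(2)
    by (intro cINF_greatest) auto
  with min_re_le[OF assms(1) z(1)] have "Re (\<tau> * z) = min_re F \<tau>" by (intro order_antisym)
  with z(1) show thesis by (rule that)
qed

text \<open>The support function of a bounded set is Lipschitz continuous in the direction.\<close>

lemma tendsto_min_re:
  assumes F: "compact F" "F \<noteq> {}" and t: "t \<longlonglongrightarrow> \<xi>"
  shows "(\<lambda>k. min_re F (t k)) \<longlonglongrightarrow> min_re F \<xi>"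
proof -
  obtain B where B: "\<And>z. z \<in> F \<Longrightarrow> cmod z \<le> B"
    using compact_imp_bounded[OF F(1)] by (auto simp: bounded_iff)
  have le: "min_re F x \<le> min_re F y + B * cmod (x - y)" for x y
  proof -
    obtain z where z: "z \<in> F" "Re (y * z) = min_re F y" by (rule min_re_attained[OF F])
    have "Re (x * z) = Re (y * z) + Re ((x - y) * z)" by (simp add: algebra_simps)
    also have "Re ((x - y) * z) \<le> cmod (x - y) * cmod z" by (metis complex_Re_le_cmod norm_mult)
    also have "\<dots> \<le> B * cmod (x - y)" using B[OF z(1)] by (simp add: mult.commute mult_right_mono)
    finally show ?thesis using min_re_le[OF F(1) z(1), of x] z(2) by linarith
  qed
  have abs: "norm (min_re F (t k) - min_re F \<xi>) \<le> B * cmod (t k - \<xi>)" for k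
    using le[of "t k" \<xi>] le[of \<xi> "t k"] by (simp add: abs_le_iff norm_minus_commute)
  have "(\<lambda>k. B * cmod (t k - \<xi>)) \<longlonglongrightarrow> B * cmod (\<xi> - \<xi>)"
    by (intro tendsto_intros t)
  then have "(\<lambda>k. min_re F (t k) - min_re F \<xi>) \<longlonglongrightarrow> 0"
    by (intro Lim_null_comparison[OF always_eventually, OF allI, OF abs]) simp
  then show ?thesis by (simp add: LIM_zero_cancel)
qed

text \<open>Coordinates along a unit direction \<open>\<xi>\<close>: turning \<open>\<xi>\<close> to \<open>t\<close> mixes in the transversal
  coordinate with the sine of the angle as its weight.\<close>

lemma Re_mult_unit:
  fixes t \<xi> u :: complex
  assumes "cmod \<xi> = 1"
  shows "Re (t * u) = Re (t * cnj \<xi>) * Re (\<xi> * u) - Im (t * cnj \<xi>) * Im (\<xi> * u)"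
proof -
  have "t * u = (t * cnj \<xi>) * (\<xi> * u)"
    using assms complex_norm_square[of \<xi>] by (simp add: algebra_simps)
  then show ?thesis by (subst \<open>t * u = _\<close>) (rule times_complex.simps(1))
qed

lemma arc_dist_le_sine:
  assumes "cmod \<xi> = 1" "cmod t = 1" "1 / 2 \<le> Re (t * cnj \<xi>)"
  shows "arc_dist \<xi> t \<le> 2 * \<bar>Im (t * cnj \<xi>)\<bar>"
proof -
  define w where "w = \<xi> / t"
  have "t * cnj t = 1" using assms(2) complex_norm_square[of t] by simp
  then have "inverse t = cnj t" by (rule inverse_unique)
  then have "w = \<xi> * cnj t" by (simp add: w_def divide_inverse)
  then have Re: "Re w = Re (t * cnj \<xi>)" and Im: "\<bar>Im w\<bar> = \<bar>Im (t * cnj \<xi>)\<bar>"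
    by (simp_all add: abs_minus_commute mult.commute)
  have "arc_dist \<xi> t = \<bar>arctan (Im w / Re w)\<bar>"
    using assms(3) Re arg_conv_arctan[of w] by (simp add: arc_dist_def w_def)
  also have "\<dots> \<le> \<bar>Im w\<bar> / Re w" using assms(3) Re abs_arctan_le[of "Im w / Re w"]
    by (simp add: abs_divide)
  also have "\<dots> \<le> \<bar>Im w\<bar> / (1 / 2)" using assms(3) Re by (intro divide_left_mono) auto
  finally show ?thesis by (simp add: Im)
qed

text \<open>If two sets have the same support value in the direction \<open>\<xi>\<close> but share no supported point,
  their supported points differ in the transversal coordinate, so the one-sided derivatives of
  the two support functions at \<open>\<xi>\<close> differ. The gap between the functions is therefore at least
  linear in the distance to \<open>\<xi>\<close> on the side where it has a fixed sign. The passage to a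
  subsequence makes the minimizers for the directions \<open>t k\<close> converge.\<close>

lemma support_gap_linear:
  assumes F: "compact F" "F \<noteq> {}" and F': "compact F'" "F' \<noteq> {}"
    and t: "\<And>k. cmod (t k) = 1" "t \<longlonglongrightarrow> \<xi>"
    and le: "\<And>k. min_re F (t k) \<le> min_re F' (t k)"
    and eq: "min_re F \<xi> = min_re F' \<xi>"
    and disj: "\<And>z. z \<in> F \<Longrightarrow> z \<in> F' \<Longrightarrow> Re (\<xi> * z) \<noteq> min_re F \<xi>"
  obtains c r where "c > 0" "strict_mono (r :: nat \<Rightarrow> nat)"
    "\<forall>\<^sub>F k in sequentially. c * arc_dist \<xi> (t (r k)) \<le> min_re F' (t (r k)) - min_re F (t (r k))"
proof -
  have \<xi>: "cmod \<xi> = 1"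
    using tendsto_norm[OF t(2)] t(1) by (simp add: LIMSEQ_const_iff)
  have "\<exists>z\<in>F. Re (t k * z) = min_re F (t k)" for k by (rule min_re_attained[OF F]) blast
  then obtain y where y: "\<And>k. y k \<in> F" "\<And>k. Re (t k * y k) = min_re F (t k)" by metis
  have "\<exists>z\<in>F'. Re (t k * z) = min_re F' (t k)" for k by (rule min_re_attained[OF F']) blast
  then obtain y' where y': "\<And>k. y' k \<in> F'" "\<And>k. Re (t k * y' k) = min_re F' (t k)" by metis
  obtain z r1 where z: "z \<in> F" "strict_mono (r1 :: nat \<Rightarrow> nat)" "(y \<circ> r1) \<longlonglongrightarrow> z"
    using F(1) y(1) unfolding compact_def by metis
  have "\<forall>k. (y' \<circ> r1) k \<in> F'" using y'(1) by simp
  then obtain z' r2 where z': "z' \<in> F'" "strict_mono (r2 :: nat \<Rightarrow> nat)" "(y' \<circ> r1 \<circ> r2) \<longlonglongrightarrow> z'"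
    using F'(1) unfolding compact_def by metis
  define r where "r = r1 \<circ> r2"
  have r: "strict_mono r" using z z' by (simp add: r_def strict_mono_o)
  have lim: "(\<lambda>k. t (r k)) \<longlonglongrightarrow> \<xi>" "(\<lambda>k. y (r k)) \<longlonglongrightarrow> z" "(\<lambda>k. y' (r k)) \<longlonglongrightarrow> z'"
    using LIMSEQ_subseq_LIMSEQ[OF t(2) r] LIMSEQ_subseq_LIMSEQ[OF z(3) z'(2)] z'(3)
    by (auto simp: r_def o_def)
  have "(\<lambda>k. Re (t (r k) * y (r k))) \<longlonglongrightarrow> Re (\<xi> * z)" by (intro tendsto_intros lim)
  moreover have "(\<lambda>k. Re (t (r k) * y (r k))) \<longlonglongrightarrow> min_re F \<xi>"
    unfolding y(2) by (rule tendsto_min_re[OF F lim(1)])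
  ultimately have ez: "Re (\<xi> * z) = min_re F \<xi>" by (rule LIMSEQ_unique)
  have "(\<lambda>k. Re (t (r k) * y' (r k))) \<longlonglongrightarrow> Re (\<xi> * z')" by (intro tendsto_intros lim)
  moreover have "(\<lambda>k. Re (t (r k) * y' (r k))) \<longlonglongrightarrow> min_re F' \<xi>"
    unfolding y'(2) by (rule tendsto_min_re[OF F' lim(1)])
  ultimately have ez': "Re (\<xi> * z') = min_re F' \<xi>" by (rule LIMSEQ_unique)
  \<comment> \<open>Both limits lie on the supporting line of \<open>\<xi>\<close>; \<open>D\<close> is their signed distance along this line.\<close>
  define D where "D = Im (\<xi> * (z' - z))"
  have "z \<noteq> z'" using disj z(1) z'(1) ez by blast
  moreover have "\<xi> \<noteq> 0" using \<xi> by auto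
  ultimately have "\<xi> * (z' - z) \<noteq> 0" by simp
  moreover have "Re (\<xi> * (z' - z)) = 0" using ez ez' eq by (simp add: right_diff_distrib)
  ultimately have D: "D \<noteq> 0" unfolding D_def by (metis complex_eqI zero_complex.sel)
  define s where "s k = Im (t (r k) * cnj \<xi>)" for k
  have "(\<lambda>k. Re (t (r k) * cnj \<xi>)) \<longlonglongrightarrow> Re (\<xi> * cnj \<xi>)" by (intro tendsto_intros lim)
  moreover have "\<xi> * cnj \<xi> = 1" using \<xi> complex_norm_square[of \<xi>] by simp
  ultimately have "(\<lambda>k. Re (t (r k) * cnj \<xi>)) \<longlonglongrightarrow> 1" by (simp del: times_complex.sel)
  then have ev1: "\<forall>\<^sub>F k in sequentially. 1 / 2 < Re (t (r k) * cnj \<xi>)"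
    by (rule order_tendstoD) simp
  have "(\<lambda>k. \<bar>Im (\<xi> * (z' - y (r k))) - D\<bar>) \<longlonglongrightarrow> \<bar>Im (\<xi> * (z' - z)) - D\<bar>"
    by (intro tendsto_intros lim)
  then have ev2: "\<forall>\<^sub>F k in sequentially. \<bar>Im (\<xi> * (z' - y (r k))) - D\<bar> < \<bar>D\<bar> / 2"
    by (rule order_tendstoD) (unfold D_def[symmetric], use D in simp)
  have "(\<lambda>k. \<bar>Im (\<xi> * (y' (r k) - z)) - D\<bar>) \<longlonglongrightarrow> \<bar>Im (\<xi> * (z' - z)) - D\<bar>"
    by (intro tendsto_intros lim)
  then have ev3: "\<forall>\<^sub>F k in sequentially. \<bar>Im (\<xi> * (y' (r k) - z)) - D\<bar> < \<bar>D\<bar> / 2"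
    by (rule order_tendstoD) (unfold D_def[symmetric], use D in simp)
  have "\<forall>\<^sub>F k in sequentially. \<bar>D\<bar> / 4 * arc_dist \<xi> (t (r k))
    \<le> min_re F' (t (r k)) - min_re F (t (r k))"
    using ev1 ev2 ev3
  proof eventually_elim
    case (elim k)
    define g where "g = min_re F' (t (r k)) - min_re F (t (r k))"
    define p where "p = Im (\<xi> * (z' - y (r k)))"
    define q where "q = Im (\<xi> * (y' (r k) - z))"
    have "0 \<le> g" using le by (simp add: g_def)
    also have "g \<le> Re (t (r k) * (z' - y (r k)))"
      using min_re_le[OF F'(1) z'(1), of "t (r k)"] y(2)[of "r k"]
        by (simp add: g_def right_diff_distrib del: times_complex.sel)
    also have "\<dots> = Re (t (r k) * cnj \<xi>) * Re (\<xi> * (z' - y (r k))) - s k * p"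
      unfolding s_def p_def by (rule Re_mult_unit[OF \<xi>])
    also have "\<dots> \<le> 0 - s k * p"
    proof (intro diff_mono mult_nonneg_nonpos order_refl)
      show "0 \<le> Re (t (r k) * cnj \<xi>)" using elim(1) by linarith
      show "Re (\<xi> * (z' - y (r k))) \<le> 0"
        using min_re_le[OF F(1) y(1)[of "r k"], of \<xi>] ez' eq
        by (simp add: right_diff_distrib del: times_complex.sel)
    qed
    \<comment> \<open>The side from which \<open>t (r k)\<close> approaches \<open>\<xi>\<close> is forced by the sign of the gap.\<close>
    finally have sp: "s k * p \<le> 0" by simp
    have "0 - s k * q \<le> Re (t (r k) * cnj \<xi>) * Re (\<xi> * (y' (r k) - z)) - s k * q"
    proof (intro diff_mono mult_nonneg_nonneg order_refl)
      show "0 \<le> Re (t (r k) * cnj \<xi>)" using elim(1) by linarith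
      show "0 \<le> Re (\<xi> * (y' (r k) - z))"
        using min_re_le[OF F'(1) y'(1)[of "r k"], of \<xi>] ez eq
        by (simp add: right_diff_distrib del: times_complex.sel)
    qed
    also have "\<dots> = Re (t (r k) * (y' (r k) - z))"
      unfolding s_def q_def by (rule Re_mult_unit[OF \<xi>, symmetric])
    also have "\<dots> \<le> g"
      using min_re_le[OF F(1) z(1), of "t (r k)"] y'(2)[of "r k"]
        by (simp add: g_def right_diff_distrib del: times_complex.sel)
    finally have sq: "- s k * q \<le> g" by simp
    have "\<bar>s k\<bar> * (\<bar>D\<bar> / 2) \<le> - s k * q"
    proof (cases "D > 0")
      case True
      then have "p > 0" "q \<ge> D / 2" using elim(2,3) unfolding p_def[symmetric] q_def[symmetric]
        by linarith+
      then have "s k \<le> 0" using sp by (simp add: mult_le_0_iff)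
      then show ?thesis using \<open>q \<ge> D / 2\<close> True mult_left_mono[of "D / 2" q "- s k"] by simp
    next
      case False
      then have "p < 0" "q \<le> D / 2"
        using D elim(2,3) unfolding p_def[symmetric] q_def[symmetric] by linarith+
      then have "s k \<ge> 0" using sp by (simp add: mult_le_0_iff)
      then show ?thesis using \<open>q \<le> D / 2\<close> False mult_left_mono[of q "D / 2" "s k"] by simp
    qed
    moreover have "arc_dist \<xi> (t (r k)) \<le> 2 * \<bar>s k\<bar>"
      unfolding s_def using elim(1) by (intro arc_dist_le_sine \<xi> t(1)) simp
    then have "\<bar>D\<bar> / 4 * arc_dist \<xi> (t (r k)) \<le> \<bar>D\<bar> / 4 * (2 * \<bar>s k\<bar>)" by (rule mult_left_mono) simp
    ultimately show ?case using sq unfolding g_def by (simp add: mult.commute)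
  qed
  then show thesis using that[of "\<bar>D\<bar> / 4" r] D r by simp
qed

section \<open>Fractals of an expanding eigenvalue\<close>

text \<open>The setting of the fractals. The eigenvector equation is stated for the words \<open>\<sigma>(a)\<close>, the
  form in which it makes the values of prefixes of \<open>\<sigma>\<^sup>n(a)\<close> self-similar.\<close>

locale expanding_substitution =
  fixes \<sigma> :: "'a::finite \<Rightarrow> 'a list" and \<beta> :: complex and \<Gamma> :: "complex^'a"
  assumes nonerasing: "\<sigma> a \<noteq> []"
    and expanding: "1 < cmod \<beta>"
    and eigen: "word_value \<Gamma> (\<sigma> a) = \<beta> * \<Gamma> $ a"
begin

text \<open>Support functions of the fractals and subfractals.\<close>

abbreviation "V a \<equiv> min_re (fractal \<sigma> \<beta> \<Gamma> a)"
abbreviation "V' a l \<equiv> min_re (subfractal \<sigma> \<beta> \<Gamma> a l)"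

lemma \<beta>_nz: "\<beta> \<noteq> 0" and sgn_\<beta>: "cmod (sgn \<beta>) = 1" and polar: "\<beta> = of_real (cmod \<beta>) * sgn \<beta>"
proof -
  show "\<beta> \<noteq> 0" using expanding by auto
  then show "cmod (sgn \<beta>) = 1" by (simp add: norm_sgn)
  show "\<beta> = of_real (cmod \<beta>) * sgn \<beta>" using \<open>\<beta> \<noteq> 0\<close> by (simp add: sgn_eq)
qed

lemma word_value_subst_word: "word_value \<Gamma> (subst_word \<sigma> w) = \<beta> * word_value \<Gamma> w"
  by (induction w) (auto simp: eigen distrib_left)

lemma word_value_subst_word_pow: "word_value \<Gamma> ((subst_word \<sigma> ^^ n) w) = \<beta> ^ n * word_value \<Gamma> w"
  by (induction n) (auto simp: word_value_subst_word)

lemma labels_at_nonempty: "([], hd (\<sigma> a), tl (\<sigma> a)) \<in> labels_at \<sigma> a"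
  using nonerasing[of a] by (simp add: labels_at_iff)

lemma labels_nonempty: "labels \<sigma> \<noteq> {}"
  using labels_at_nonempty labels_at_subset by fast

lemma label_seqs_nonempty: "label_seqs \<sigma> a \<noteq> {}"
proof -
  define f where "f a = ([] :: 'a list, hd (\<sigma> a), tl (\<sigma> a))" for a
  have f: "f b \<in> labels_at \<sigma> b" for b using labels_at_nonempty by (simp add: f_def)
  have "rec_nat (f a) (\<lambda>_ l. f (letter_of l)) \<in> label_seqs \<sigma> a"
    by (auto simp: label_seqs_def f)
  then show ?thesis by blast
qed

lemma label_seqs_from_nonempty:
  assumes "l \<in> labels_at \<sigma> a"
  shows "label_seqs_from \<sigma> a l \<noteq> {}"
proof -
  obtain x where "x \<in> label_seqs \<sigma> (letter_of l)" using label_seqs_nonempty by blast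
  then have "case_nat l x \<in> label_seqs_from \<sigma> a l" using assms by (simp add: label_seqs_Cons)
  then show ?thesis by blast
qed

definition "digit_bound = (\<Sum>l\<in>labels \<sigma>. cmod (word_value \<Gamma> (prefix_of l)))"

lemma term_bound:
  assumes "x \<in> label_seqs \<sigma> a"
  shows "norm (word_value \<Gamma> (prefix_of (x m)) / \<beta> ^ Suc m) \<le> digit_bound * (1 / cmod \<beta>) ^ Suc m"
proof -
  have "cmod (word_value \<Gamma> (prefix_of (x m))) \<le> digit_bound"
    unfolding digit_bound_def
      by (rule member_le_sum[OF label_seqs_nth[OF assms]]) (auto simp: finite_labels)
  then have "cmod (word_value \<Gamma> (prefix_of (x m))) / cmod \<beta> ^ Suc m \<le> digit_bound / cmod \<beta> ^ Suc m"
    by (intro divide_right_mono) auto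
  then show ?thesis by (simp only: norm_divide norm_power power_one_over) simp
qed

lemma summable_bound: "summable (\<lambda>m. digit_bound * (1 / cmod \<beta>) ^ Suc m)"
  using expanding
  by (intro summable_mult summable_Suc_iff[THEN iffD2] summable_geometric)
    (simp add: divide_less_eq)

lemma summable_represented:
  assumes "x \<in> label_seqs \<sigma> a"
  shows "summable (\<lambda>m. word_value \<Gamma> (prefix_of (x m)) / \<beta> ^ Suc m)"
  by (rule summable_comparison_test'[OF summable_bound]) (rule term_bound[OF assms])

lemma represented_bound:
  assumes "x \<in> label_seqs \<sigma> a"
  shows "cmod (represented \<beta> \<Gamma> x) \<le> (\<Sum>m. digit_bound * (1 / cmod \<beta>) ^ Suc m)"
  unfolding represented_def by (rule norm_suminf_le[OF term_bound[OF assms] summable_bound])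

lemma represented_Cons:
  assumes "x \<in> label_seqs \<sigma> a"
  shows "represented \<beta> \<Gamma> x = (word_value \<Gamma> (prefix_of (x 0)) + represented \<beta> \<Gamma> (\<lambda>m. x (Suc m))) / \<beta>"
proof -
  have "x \<in> label_seqs_from \<sigma> a (x 0)" using assms by (simp add: label_seqs_from_def)
  then have s: "summable (\<lambda>m. word_value \<Gamma> (prefix_of (x (Suc m))) / \<beta> ^ Suc m)"
    using summable_represented unfolding label_seqs_Cons by blast
  have "(\<Sum>m. word_value \<Gamma> (prefix_of (x (Suc m))) / \<beta> ^ Suc (Suc m)) =
        (\<Sum>m. (word_value \<Gamma> (prefix_of (x (Suc m))) / \<beta> ^ Suc m) / \<beta>)"
    by (intro suminf_cong) simp
  also have "\<dots> = represented \<beta> \<Gamma> (\<lambda>m. x (Suc m)) / \<beta>"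
    unfolding represented_def using suminf_divide[OF s, of \<beta>] by simp
  finally show ?thesis
    using suminf_split_head[OF summable_represented[OF assms]]
    by (simp add: represented_def add_divide_distrib)
qed

text \<open>Each common label divides the distance by \<open>\<bar>\<beta>\<bar>\<close>, by \<open>represented_Cons\<close>. With the sequential
  compactness of the label sequences this makes the fractals compact.\<close>

lemma represented_dist:
  assumes "x \<in> label_seqs \<sigma> a" "y \<in> label_seqs \<sigma> a" "\<And>m. m < n \<Longrightarrow> x m = y m"
  shows "cmod (represented \<beta> \<Gamma> x - represented \<beta> \<Gamma> y)
    \<le> 2 * (\<Sum>m. digit_bound * (1 / cmod \<beta>) ^ Suc m) * (1 / cmod \<beta>) ^ n"
  using assms
proof (induction n arbitrary: a x y)
  case 0
  then show ?case
    using norm_triangle_ineq4[of "represented \<beta> \<Gamma> x" "represented \<beta> \<Gamma> y"]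
      represented_bound[of x a] represented_bound[of y a] unfolding power_0 mult_1_right by linarith
next
  case (Suc n)
  define x' where "x' m = x (Suc m)" for m
  define y' where "y' m = y (Suc m)" for m
  have "x 0 = y 0" using Suc.prems(3) by simp
  have "x \<in> label_seqs_from \<sigma> a (x 0)" "y \<in> label_seqs_from \<sigma> a (y 0)"
    using Suc.prems by (auto simp: label_seqs_from_def)
  then have xy: "x' \<in> label_seqs \<sigma> (letter_of (x 0))" "y' \<in> label_seqs \<sigma> (letter_of (x 0))"
    unfolding label_seqs_Cons x'_def y'_def \<open>x 0 = y 0\<close> by auto
  from xy have IH: "cmod (represented \<beta> \<Gamma> x' - represented \<beta> \<Gamma> y')
    \<le> 2 * (\<Sum>m. digit_bound * (1 / cmod \<beta>) ^ Suc m) * (1 / cmod \<beta>) ^ n"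
    by (rule Suc.IH) (use Suc.prems(3) in \<open>simp add: x'_def y'_def\<close>)
  have "represented \<beta> \<Gamma> x - represented \<beta> \<Gamma> y = (represented \<beta> \<Gamma> x' - represented \<beta> \<Gamma> y') / \<beta>"
    using represented_Cons[OF Suc.prems(1)] represented_Cons[OF Suc.prems(2)] \<open>x 0 = y 0\<close>
    by (simp add: x'_def[abs_def] y'_def[abs_def] diff_divide_distrib[symmetric])
  then have "cmod (represented \<beta> \<Gamma> x - represented \<beta> \<Gamma> y)
    = cmod (represented \<beta> \<Gamma> x' - represented \<beta> \<Gamma> y') * (1 / cmod \<beta>)" by (simp add: norm_divide)
  also have "\<dots> \<le> 2 * (\<Sum>m. digit_bound * (1 / cmod \<beta>) ^ Suc m) * (1 / cmod \<beta>) ^ n * (1 / cmod \<beta>)"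
    by (intro mult_right_mono IH) simp
  finally show ?case by (simp only: power_Suc mult.assoc mult.commute[of "1 / cmod \<beta>"])
qed

lemma compact_subfractal: "compact (subfractal \<sigma> \<beta> \<Gamma> a l)"
  unfolding compact_def
proof (intro allI impI)
  fix f :: "nat \<Rightarrow> complex" assume "\<forall>n. f n \<in> subfractal \<sigma> \<beta> \<Gamma> a l"
  then have "\<forall>n. \<exists>x. x \<in> label_seqs_from \<sigma> a l \<and> f n = represented \<beta> \<Gamma> x"
    by (auto simp: subfractal_def)
  then obtain X where X: "\<And>n. X n \<in> label_seqs_from \<sigma> a l" "\<And>n. f n = represented \<beta> \<Gamma> (X n)"
    by metis
  obtain r x where r: "strict_mono (r :: nat \<Rightarrow> nat)" and x: "x \<in> label_seqs_from \<sigma> a l"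
    and ev: "\<And>n. \<forall>\<^sub>F k in sequentially. X (r k) n = x n"
    by (rule label_seqs_seq_compact[of X, OF X(1)], blast)
  define D where "D = 2 * (\<Sum>m. digit_bound * (1 / cmod \<beta>) ^ Suc m)"
  have "(\<lambda>k. represented \<beta> \<Gamma> (X (r k))) \<longlonglongrightarrow> represented \<beta> \<Gamma> x"
  proof (rule tendstoI)
    fix e :: real assume "e > 0"
    have "(\<lambda>n. D * (1 / cmod \<beta>) ^ n) \<longlonglongrightarrow> D * 0"
      using expanding by (intro tendsto_intros LIMSEQ_power_zero) (simp add: divide_less_eq)
    then have "\<forall>\<^sub>F n in sequentially. D * (1 / cmod \<beta>) ^ n < e"
      by (rule order_tendstoD) (use \<open>e > 0\<close> in simp)
    then obtain n where n: "D * (1 / cmod \<beta>) ^ n < e" using eventually_happens by fastforce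
    have "\<forall>\<^sub>F k in sequentially. \<forall>m\<in>{..<n}. X (r k) m = x m"
      by (intro eventually_ball_finite ballI ev) simp
    then show "\<forall>\<^sub>F k in sequentially. dist (represented \<beta> \<Gamma> (X (r k))) (represented \<beta> \<Gamma> x) < e"
    proof eventually_elim
      case (elim k)
      have "cmod (represented \<beta> \<Gamma> (X (r k)) - represented \<beta> \<Gamma> x) \<le> D * (1 / cmod \<beta>) ^ n"
        unfolding D_def using elim x X(1)[of "r k"]
        by (intro represented_dist[of _ a]) (auto simp: label_seqs_from_def)
      then show ?case using n by (simp add: dist_norm)
    qed
  qed
  then have "(f \<circ> r) \<longlonglongrightarrow> represented \<beta> \<Gamma> x" by (simp add: o_def X(2))
  then show "\<exists>l\<in>subfractal \<sigma> \<beta> \<Gamma> a l. \<exists>r. strict_mono r \<and> (f \<circ> r) \<longlonglongrightarrow> l"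
    using r x unfolding subfractal_def by blast
qed

lemma fractal_eq_Union: "fractal \<sigma> \<beta> \<Gamma> a = (\<Union>l\<in>labels_at \<sigma> a. subfractal \<sigma> \<beta> \<Gamma> a l)"
proof -
  have "label_seqs \<sigma> a = (\<Union>l\<in>labels_at \<sigma> a. label_seqs_from \<sigma> a l)"
    by (auto simp: label_seqs_from_def label_seqs_def)
  then show ?thesis by (auto simp: fractal_def subfractal_def)
qed

lemma compact_fractal: "compact (fractal \<sigma> \<beta> \<Gamma> a)"
  unfolding fractal_eq_Union by (intro compact_UN finite_labels_at compact_subfractal)

lemma fractal_nonempty: "fractal \<sigma> \<beta> \<Gamma> a \<noteq> {}"
  by (simp add: fractal_def label_seqs_nonempty)

lemma subfractal_nonempty: "l \<in> labels_at \<sigma> a \<Longrightarrow> subfractal \<sigma> \<beta> \<Gamma> a l \<noteq> {}"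
  by (simp add: subfractal_def label_seqs_from_nonempty)

lemma subfractal_eq:
  assumes "l \<in> labels_at \<sigma> a"
  shows "subfractal \<sigma> \<beta> \<Gamma> a l =
    (\<lambda>z. (word_value \<Gamma> (prefix_of l) + z) / \<beta>) ` fractal \<sigma> \<beta> \<Gamma> (letter_of l)"
proof (intro equalityI subsetI)
  fix z assume "z \<in> subfractal \<sigma> \<beta> \<Gamma> a l"
  then obtain x where x: "x \<in> label_seqs_from \<sigma> a l" "z = represented \<beta> \<Gamma> x"
    by (auto simp: subfractal_def)
  then have "x \<in> label_seqs \<sigma> a" "x 0 = l" "(\<lambda>m. x (Suc m)) \<in> label_seqs \<sigma> (letter_of l)"
    using label_seqs_Cons[of x \<sigma> a l] by (auto simp: label_seqs_from_def)
  then show "z \<in> (\<lambda>z. (word_value \<Gamma> (prefix_of l) + z) / \<beta>) ` fractal \<sigma> \<beta> \<Gamma> (letter_of l)"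
    using represented_Cons[of x a] x(2) by (auto simp: fractal_def)
next
  fix z assume "z \<in> (\<lambda>z. (word_value \<Gamma> (prefix_of l) + z) / \<beta>) ` fractal \<sigma> \<beta> \<Gamma> (letter_of l)"
  then obtain y where y: "y \<in> label_seqs \<sigma> (letter_of l)"
    "z = (word_value \<Gamma> (prefix_of l) + represented \<beta> \<Gamma> y) / \<beta>" by (auto simp: fractal_def)
  have x: "case_nat l y \<in> label_seqs_from \<sigma> a l" using assms y by (simp add: label_seqs_Cons)
  then have "case_nat l y \<in> label_seqs \<sigma> a" by (simp add: label_seqs_from_def)
  then have "represented \<beta> \<Gamma> (case_nat l y) = z" using represented_Cons y(2) by force
  then show "z \<in> subfractal \<sigma> \<beta> \<Gamma> a l" using x by (auto simp: subfractal_def)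
qed

text \<open>Division by \<open>\<beta>\<close> rotates by \<open>sgn \<beta>\<close> backwards and divides the length by \<open>\<bar>\<beta>\<bar>\<close>.\<close>

lemma Re_scaled: "cmod \<beta> * Re (sgn \<beta> * t * (w / \<beta>)) = Re (t * w)"
proof -
  have "of_real (cmod \<beta>) * (sgn \<beta> * t * (w / \<beta>)) = t * w"
    using \<beta>_nz polar by (metis (no_types, lifting) mult.assoc mult.commute
      nonzero_mult_div_cancel_left times_divide_eq_right)
  then show ?thesis by (metis Re_complex_of_real Im_complex_of_real mult_zero_left diff_zero
    times_complex.sel(1))
qed

text \<open>The support-function form of \<open>subfractal_eq\<close>.\<close>

lemma support_recursion:
  assumes "l \<in> labels_at \<sigma> a"
  shows "cmod \<beta> * V' a l (sgn \<beta> * t) = Re (t * word_value \<Gamma> (prefix_of l)) + V (letter_of l) t"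
proof (rule antisym)
  note c = compact_subfractal[of a l] and n = subfractal_nonempty[OF assms]
  obtain z where z: "z \<in> fractal \<sigma> \<beta> \<Gamma> (letter_of l)" "Re (t * z) = V (letter_of l) t"
    by (rule min_re_attained[OF compact_fractal fractal_nonempty])
  have "V' a l (sgn \<beta> * t) \<le> Re (sgn \<beta> * t * ((word_value \<Gamma> (prefix_of l) + z) / \<beta>))"
    using z(1) by (intro min_re_le[OF c]) (auto simp: subfractal_eq[OF assms])
  then have "cmod \<beta> * V' a l (sgn \<beta> * t)
    \<le> cmod \<beta> * Re (sgn \<beta> * t * ((word_value \<Gamma> (prefix_of l) + z) / \<beta>))"
    by (rule mult_left_mono) simp
  then show "cmod \<beta> * V' a l (sgn \<beta> * t) \<le> Re (t * word_value \<Gamma> (prefix_of l)) + V (letter_of l) t"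
    unfolding Re_scaled distrib_left plus_complex.sel z(2) .
  obtain y where y: "y \<in> subfractal \<sigma> \<beta> \<Gamma> a l" "Re (sgn \<beta> * t * y) = V' a l (sgn \<beta> * t)"
    by (rule min_re_attained[OF c n])
  then obtain x where x: "x \<in> fractal \<sigma> \<beta> \<Gamma> (letter_of l)"
    "y = (word_value \<Gamma> (prefix_of l) + x) / \<beta>"
    by (auto simp: subfractal_eq[OF assms])
  have "cmod \<beta> * V' a l (sgn \<beta> * t) = Re (t * word_value \<Gamma> (prefix_of l)) + Re (t * x)"
    unfolding y(2)[symmetric] x(2) Re_scaled distrib_left plus_complex.sel ..
  then show "Re (t * word_value \<Gamma> (prefix_of l)) + V (letter_of l) t \<le> cmod \<beta> * V' a l (sgn \<beta> * t)"
    using min_re_le[OF compact_fractal x(1), of t] by linarith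
qed

lemma support_le: "l \<in> labels_at \<sigma> a \<Longrightarrow> V a t \<le> V' a l t"
proof -
  assume l: "l \<in> labels_at \<sigma> a"
  obtain y where y: "y \<in> subfractal \<sigma> \<beta> \<Gamma> a l" "Re (t * y) = V' a l t"
    by (rule min_re_attained[OF compact_subfractal subfractal_nonempty[OF l]])
  then show ?thesis using l min_re_le[OF compact_fractal, of y a t] by (auto simp: fractal_eq_Union)
qed

text \<open>Each refinement of the prefix by one label can only increase the right-hand side, because
  the support function of a subfractal is at least that of the whole fractal.\<close>

lemma support_prefix_bound:
  assumes "(subst_word \<sigma> ^^ n) [a] = u @ c # v"
  shows "cmod \<beta> ^ n * V a (sgn \<beta> ^ n * t) \<le> Re (t * word_value \<Gamma> u) + V c t"
  using assms
proof (induction n arbitrary: u c v t)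
  case 0
  then show ?case by (cases u) auto
next
  case (Suc n)
  then have "subst_word \<sigma> ((subst_word \<sigma> ^^ n) [a]) = u @ c # v" by simp
  then obtain w1 b w2 p s where w: "(subst_word \<sigma> ^^ n) [a] = w1 @ b # w2" "\<sigma> b = p @ c # s"
    "u = subst_word \<sigma> w1 @ p" by (rule subst_word_split_at_letter)
  have l: "(p, c, s) \<in> labels_at \<sigma> b" using w(2) by (simp add: labels_at_iff)
  have "cmod \<beta> * (cmod \<beta> ^ n * V a (sgn \<beta> ^ n * (sgn \<beta> * t)))
      \<le> cmod \<beta> * (Re (sgn \<beta> * t * word_value \<Gamma> w1) + V b (sgn \<beta> * t))"
    by (intro mult_left_mono Suc.IH[OF w(1)]) simp
  also have "\<dots> \<le> cmod \<beta> * (Re (sgn \<beta> * t * word_value \<Gamma> w1) + V' b (p, c, s) (sgn \<beta> * t))"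
    by (intro mult_left_mono add_left_mono support_le l) simp
  also have "\<dots> = cmod \<beta> * Re (sgn \<beta> * t * ((\<beta> * word_value \<Gamma> w1) / \<beta>))
    + (Re (t * word_value \<Gamma> p) + V c t)"
    using support_recursion[OF l] \<beta>_nz by (simp add: distrib_left)
  also have "\<dots> = Re (t * word_value \<Gamma> u) + V c t"
    unfolding Re_scaled by (simp add: w(3) word_value_subst_word distrib_left)
  finally show ?case by (simp add: mult.assoc mult.left_commute mult.commute)
qed

end

section \<open>Good directions separate the optimal label from the others\<close>

context expanding_substitution
begin

text \<open>A common supported point of the subfractals of \<open>l\<close> and \<open>l'\<close> would be an extreme point with
  two representations, which differ in their first label. So the unique representation property
  supplies the disjointness that a linear gap requires.\<close>

lemma support_gap_near_ambiguous_direction: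
  assumes urp: "unique_representation \<sigma> \<beta> \<Gamma>"
    and l: "l \<in> labels_at \<sigma> a" and l': "l' \<in> labels_at \<sigma> a" and neq: "l \<noteq> l'"
    and t: "\<And>k. cmod (t k) = 1" "t \<longlonglongrightarrow> \<xi>"
    and opt: "\<And>k. V a (t k) = V' a l (t k)"
    and gap: "(\<lambda>k. V' a l' (t k) - V a (t k)) \<longlonglongrightarrow> 0"
  obtains c r where "\<xi> \<in> ambiguous_directions \<sigma> \<beta> \<Gamma>" "c > 0" "strict_mono (r :: nat \<Rightarrow> nat)"
    "\<forall>\<^sub>F k in sequentially. c * arc_dist \<xi> (t (r k)) \<le> V' a l' (t (r k)) - V a (t (r k))"
proof -
  have \<xi>: "cmod \<xi> = 1"
    using tendsto_norm[OF t(2)] t(1) by (simp add: LIMSEQ_const_iff)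
  note cl = compact_subfractal[of a l] and nl = subfractal_nonempty[OF l]
  note cl' = compact_subfractal[of a l'] and nl' = subfractal_nonempty[OF l']
  have limV: "(\<lambda>k. V a (t k)) \<longlonglongrightarrow> V a \<xi>"
    by (rule tendsto_min_re[OF compact_fractal fractal_nonempty t(2)])
  have "(\<lambda>k. V a (t k)) \<longlonglongrightarrow> V' a l \<xi>" unfolding opt by (rule tendsto_min_re[OF cl nl t(2)])
  then have e: "V a \<xi> = V' a l \<xi>" using limV LIMSEQ_unique by blast
  have "(\<lambda>k. V' a l' (t k) - V a (t k)) \<longlonglongrightarrow> V' a l' \<xi> - V a \<xi>"
    by (intro tendsto_diff limV tendsto_min_re[OF cl' nl' t(2)])
  then have e': "V a \<xi> = V' a l' \<xi>" using gap LIMSEQ_unique by fastforce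
  have amb: "\<xi> \<in> ambiguous_directions \<sigma> \<beta> \<Gamma>"
    unfolding ambiguous_directions_def ambiguous_directions_at_def
    using l l' neq e e' \<xi> by (intro UN_I[of a] CollectI conjI bexI[of _ l] bexI[of _ l']) auto
  have disj: "Re (\<xi> * z) \<noteq> V' a l \<xi>"
    if zl: "z \<in> subfractal \<sigma> \<beta> \<Gamma> a l" and zl': "z \<in> subfractal \<sigma> \<beta> \<Gamma> a l'" for z
  proof
    assume ex: "Re (\<xi> * z) = V' a l \<xi>"
    have z: "z \<in> fractal \<sigma> \<beta> \<Gamma> a" using zl l by (auto simp: fractal_eq_Union)
    obtain x where x: "x \<in> label_seqs_from \<sigma> a l" "z = represented \<beta> \<Gamma> x" using zl
      by (auto simp: subfractal_def)
    obtain y where y: "y \<in> label_seqs_from \<sigma> a l'" "z = represented \<beta> \<Gamma> y" using zl'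
      by (auto simp: subfractal_def)
    have "\<exists>\<tau>\<in>sphere 0 1. Re (\<tau> * z) = V a \<tau>" using \<xi> ex e by (intro bexI[of _ \<xi>]) auto
    then have "\<exists>!x. x \<in> label_seqs \<sigma> a \<and> represented \<beta> \<Gamma> x = z"
      using urp z unfolding unique_representation_def by blast
    then have "x = y" using x y by (auto simp: label_seqs_from_def)
    then show False using x(1) y(1) neq by (auto simp: label_seqs_from_def)
  qed
  obtain c r where "c > 0" "strict_mono (r :: nat \<Rightarrow> nat)"
    "\<forall>\<^sub>F k in sequentially. c * arc_dist \<xi> (t (r k)) \<le> V' a l' (t (r k)) - V' a l (t (r k))"
  proof (rule support_gap_linear[OF cl nl cl' nl' t])
    show "V' a l (t k) \<le> V' a l' (t k)" for k using support_le[OF l', of "t k"] opt[of k] by simp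
    show "V' a l \<xi> = V' a l' \<xi>" using e e' by simp
    show "Re (\<xi> * z) \<noteq> V' a l \<xi>" if "z \<in> subfractal \<sigma> \<beta> \<Gamma> a l" "z \<in> subfractal \<sigma> \<beta> \<Gamma> a l'" for z
      using disj that .
  qed
  then show thesis using that[OF amb] by (simp add: opt)
qed

text \<open>Along a sequence of levels at which the scaled gap stays bounded, the gap itself tends to 0
  and the directions accumulate at an ambiguous direction, where the gap is linear in the
  distance. Good directions approach it no faster than \<open>A\<^sup>-\<^sup>n\<close>, while the bound on the gap decays
  like \<open>\<bar>\<beta>\<bar>\<^sup>-\<^sup>n\<close> and \<open>A < \<bar>\<beta>\<bar>\<close>.\<close>

lemma good_direction_gap:
  assumes urp: "unique_representation \<sigma> \<beta> \<Gamma>" and good: "good_direction \<sigma> \<beta> \<Gamma> \<tau>"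
    and d: "\<And>m. d m \<in> labels_at \<sigma> (letter_of (d (Suc m)))"
    and opt: "\<And>m. V (letter_of (d (Suc m))) (sgn \<beta> ^ Suc m * \<tau>)
      = V' (letter_of (d (Suc m))) (d m) (sgn \<beta> ^ Suc m * \<tau>)"
  shows "\<forall>\<^sub>F m in sequentially. \<forall>l\<in>labels_at \<sigma> (letter_of (d (Suc m))). l \<noteq> d m \<longrightarrow>
    C \<le> cmod \<beta> ^ Suc m * (V' (letter_of (d (Suc m))) l (sgn \<beta> ^ Suc m * \<tau>)
      - V (letter_of (d (Suc m))) (sgn \<beta> ^ Suc m * \<tau>))"
proof (rule ccontr)
  define t where "t m = sgn \<beta> ^ Suc m * \<tau>" for m
  define a where "a m = letter_of (d (Suc m))" for m
  define bad where "bad m l \<longleftrightarrow> l \<in> labels_at \<sigma> (a m) \<and> l \<noteq> d m \<and>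
    cmod \<beta> ^ Suc m * (V' (a m) l (t m) - V (a m) (t m)) < C" for m l
  have t: "cmod (t m) = 1" for m
    using good by (simp add: t_def good_direction_def norm_mult norm_power sgn_\<beta>)
  assume "\<not> ?thesis"
  then have "\<exists>\<^sub>F m in sequentially. \<exists>l. bad m l"
    by (simp add: not_eventually bad_def a_def t_def not_le Bex_def conj_assoc)
  then have inf: "infinite {m. \<exists>l. bad m l}"
    by (simp add: frequently_cofinite flip: cofinite_eq_sequentially)
  have "\<forall>m\<in>{m. \<exists>l. bad m l}. \<exists>l. bad m l" by simp
  then obtain l where l: "\<And>m. m \<in> {m. \<exists>l. bad m l} \<Longrightarrow> bad m (l m)" by metis
  \<comment> \<open>Pigeonhole: letter, optimal label and competing label may be taken constant.\<close>
  define g where "g m = (a m, d m, l m)" for m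
  have "d m \<in> labels \<sigma>" for m using d labels_at_subset by fast
  moreover have "l m \<in> labels \<sigma>" if "m \<in> {m. \<exists>l. bad m l}" for m
    using l[OF that] labels_at_subset by (fastforce simp: bad_def)
  ultimately have "g ` {m. \<exists>l. bad m l} \<subseteq> UNIV \<times> labels \<sigma> \<times> labels \<sigma>"
    unfolding g_def by (intro image_subsetI SigmaI UNIV_I)
  then have "finite (g ` {m. \<exists>l. bad m l})" by (rule finite_subset) (simp add: finite_labels)
  then obtain m0 where "infinite {m \<in> {m. \<exists>l. bad m l}. g m = g m0}"
    using pigeonhole_infinite[OF inf] by blast
  then obtain r where r: "strict_mono (r :: nat \<Rightarrow> nat)"
    "\<forall>n. r n \<in> {m \<in> {m. \<exists>l. bad m l}. g m = g m0}"
    using infinite_enumerate by blast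
  have "\<forall>k. (t \<circ> r) k \<in> sphere 0 1" using t by simp
  moreover have "compact (sphere (0::complex) 1)" by simp
  ultimately obtain \<xi> q where q: "strict_mono (q :: nat \<Rightarrow> nat)" "(t \<circ> r \<circ> q) \<longlonglongrightarrow> \<xi>"
    unfolding compact_def by metis
  define n where "n = r \<circ> q"
  have n: "strict_mono n" using r(1) q(1) by (simp add: n_def strict_mono_o)
  have bad: "bad (n k) (l (n k))" and g: "g (n k) = g m0" for k
    using r(2) l by (auto simp: n_def)
  have const: "a (n k) = a m0" "d (n k) = d m0" "l (n k) = l m0" for k using g[of k]
    by (auto simp: g_def)
  define gap where "gap k = V' (a m0) (l m0) (t (n k)) - V (a m0) (t (n k))" for k
  have lm: "l m0 \<in> labels_at \<sigma> (a m0)" "d m0 \<noteq> l m0" using bad[of 0] by (auto simp: bad_def const)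
  have dm: "d m0 \<in> labels_at \<sigma> (a m0)" using d by (simp add: a_def)
  have gap_ub: "cmod \<beta> ^ Suc (n k) * gap k < C" for k using bad[of k]
    by (simp add: bad_def const gap_def)
  have gap_nn: "0 \<le> gap k" for k using support_le[OF lm(1)] by (simp add: gap_def)
  have suc: "filterlim (\<lambda>k. Suc (n k)) sequentially sequentially"
    using filterlim_subseq[OF n] filterlim_Suc by (rule filterlim_compose[rotated])
  have "(\<lambda>k. C * (1 / cmod \<beta>) ^ k) \<longlonglongrightarrow> C * 0"
    using expanding by (intro tendsto_intros LIMSEQ_power_zero) (simp add: divide_less_eq)
  then have "(\<lambda>k. C * (1 / cmod \<beta>) ^ Suc (n k)) \<longlonglongrightarrow> 0"
    using filterlim_compose[OF _ suc] by fastforce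
  then have gap0: "gap \<longlonglongrightarrow> 0"
  proof (rule tendsto_sandwich[rotated 3])
    show "\<forall>\<^sub>F k in sequentially. gap k \<le> C * (1 / cmod \<beta>) ^ Suc (n k)"
      using gap_ub \<beta>_nz by (intro always_eventually allI)
        (simp add: power_one_over field_simps less_imp_le)
  qed (auto simp: gap_nn)
  obtain c p where amb: "\<xi> \<in> ambiguous_directions \<sigma> \<beta> \<Gamma>" and c: "c > 0"
    and p: "strict_mono (p :: nat \<Rightarrow> nat)"
    and ev: "\<forall>\<^sub>F k in sequentially. c * arc_dist \<xi> (t (n (p k))) \<le> gap (p k)"
  proof (rule support_gap_near_ambiguous_direction[OF urp dm lm(1) lm(2)])
    show "cmod (t (n k)) = 1" for k by (rule t)
    show "(\<lambda>k. t (n k)) \<longlonglongrightarrow> \<xi>" using q(2) by (simp add: n_def o_def)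
    show "V (a m0) (t (n k)) = V' (a m0) (d m0) (t (n k))" for k
      using opt[of "n k"] const[of k] by (simp add: a_def t_def)
    show "(\<lambda>k. V' (a m0) (l m0) (t (n k)) - V (a m0) (t (n k))) \<longlonglongrightarrow> 0"
      using gap0 by (simp add: gap_def[abs_def])
  qed (simp add: gap_def)
  obtain A where A: "1 < A" "A < cmod \<beta>"
    and lim: "liminf (\<lambda>n. ereal (A ^ n * arc_dist \<xi> (sgn \<beta> ^ n * \<tau>))) = \<infinity>"
    using good amb by (auto simp: good_direction_def)
  have "ereal 1 < liminf (\<lambda>n. ereal (A ^ n * arc_dist \<xi> (sgn \<beta> ^ n * \<tau>)))" by (simp add: lim)
  then have ev1: "\<forall>\<^sub>F n in sequentially. 1 < A ^ n * arc_dist \<xi> (sgn \<beta> ^ n * \<tau>)"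
    by (auto dest!: less_LiminfD simp: one_ereal_def)
  have suc': "filterlim (\<lambda>k. Suc (n (p k))) sequentially sequentially"
    using filterlim_compose[OF suc filterlim_subseq[OF p]] .
  have ev2: "\<forall>\<^sub>F k in sequentially. 1 < A ^ Suc (n (p k)) * arc_dist \<xi> (t (n (p k)))"
    using eventually_compose_filterlim[OF ev1 suc'] by (simp add: t_def)
  have "(\<lambda>k. C * (A / cmod \<beta>) ^ k) \<longlonglongrightarrow> C * 0"
    using A by (intro tendsto_intros LIMSEQ_power_zero) (auto simp: divide_less_eq)
  then have "(\<lambda>k. C * (A / cmod \<beta>) ^ Suc (n (p k))) \<longlonglongrightarrow> 0"
    using filterlim_compose[OF _ suc'] by fastforce
  then have ev3: "\<forall>\<^sub>F k in sequentially. C * (A / cmod \<beta>) ^ Suc (n (p k)) < c"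
    by (rule order_tendstoD) (rule c)
  have "\<forall>\<^sub>F k in sequentially. False"
    using ev ev2 ev3
  proof eventually_elim
    case (elim k)
    define N where "N = Suc (n (p k))"
    have "c < c * (A ^ N * arc_dist \<xi> (t (n (p k))))" using elim(2) c by (simp add: N_def)
    also have "\<dots> = A ^ N * (c * arc_dist \<xi> (t (n (p k))))" by (simp only: mult.left_commute)
    also have "\<dots> \<le> A ^ N * gap (p k)" using elim(1) A by (intro mult_left_mono) auto
    also have "\<dots> = (A / cmod \<beta>) ^ N * (cmod \<beta> ^ N * gap (p k))"
      using \<beta>_nz by (simp add: power_divide)
    also have "\<dots> \<le> (A / cmod \<beta>) ^ N * C"
      using gap_ub[of "p k"] A unfolding N_def by (intro mult_left_mono) auto
    also have "\<dots> < c" using elim(3) by (simp add: N_def mult.commute)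
    finally show False .
  qed
  then show False by simp
qed

end

section \<open>Two-sided sequences with a given decomposition\<close>

text \<open>The two halves of the central word of a prefix-suffix decomposition up to level \<open>m\<close>.\<close>

definition left_word :: "('a \<Rightarrow> 'a list) \<Rightarrow> (nat \<Rightarrow> 'a label) \<Rightarrow> nat \<Rightarrow> 'a list" where
  "left_word \<sigma> d m = concat (map (\<lambda>i. (subst_word \<sigma> ^^ i) (prefix_of (d i))) (rev [0..<Suc m]))"

definition right_word :: "('a \<Rightarrow> 'a list) \<Rightarrow> (nat \<Rightarrow> 'a label) \<Rightarrow> nat \<Rightarrow> 'a list" where
  "right_word \<sigma> d m =
     letter_of (d 0) # concat (map (\<lambda>i. (subst_word \<sigma> ^^ i) (suffix_of (d i))) [0..<Suc m])"

lemma left_word_simps: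
  "left_word \<sigma> d 0 = prefix_of (d 0)"
  "left_word \<sigma> d (Suc m) = (subst_word \<sigma> ^^ Suc m) (prefix_of (d (Suc m))) @ left_word \<sigma> d m"
  by (simp_all add: left_word_def)

lemma right_word_simps:
  "right_word \<sigma> d 0 = letter_of (d 0) # suffix_of (d 0)"
  "right_word \<sigma> d (Suc m) = right_word \<sigma> d m @ (subst_word \<sigma> ^^ Suc m) (suffix_of (d (Suc m)))"
  by (simp_all add: right_word_def)

text \<open>Each level wraps \<open>\<sigma>\<^sup>m(c\<^sub>m)\<close>, the central word so far, into \<open>\<sigma>\<^sup>m(p\<^sub>m c\<^sub>m s\<^sub>m)\<close>, which is
  \<open>\<sigma>\<^sup>m(\<sigma>(c\<^sub>m\<^sub>+\<^sub>1))\<close>.\<close>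

lemma central_word:
  assumes "\<And>m. d m \<in> labels_at \<sigma> (letter_of (d (Suc m)))"
  shows "left_word \<sigma> d m @ right_word \<sigma> d m = (subst_word \<sigma> ^^ Suc m) [letter_of (d (Suc m))]"
proof (induction m)
  case 0
  then show ?case using assms[of 0] by (simp add: left_word_simps right_word_simps labels_at_iff)
next
  case (Suc m)
  have "(subst_word \<sigma> ^^ Suc (Suc m)) [letter_of (d (Suc (Suc m)))]
      = (subst_word \<sigma> ^^ Suc m) (\<sigma> (letter_of (d (Suc (Suc m)))))"
    by (simp only: funpow_Suc_right o_apply subst_word_simps append_Nil2)
  also have "\<sigma> (letter_of (d (Suc (Suc m))))
    = prefix_of (d (Suc m)) @ [letter_of (d (Suc m))] @ suffix_of (d (Suc m))"
    using assms[of "Suc m"] by (simp add: labels_at_iff)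
  finally show ?case
    unfolding subst_word_pow_append Suc.IH[symmetric] left_word_simps right_word_simps by simp
qed

lemma subst_word_pow_nonempty:
  assumes "\<And>a. \<sigma> a \<noteq> []" "w \<noteq> []"
  shows "(subst_word \<sigma> ^^ n) w \<noteq> []"
proof (induction n)
  case (Suc n)
  then show ?case using assms(1) by (cases "(subst_word \<sigma> ^^ n) w") auto
qed (use assms in simp)

lemma prefix_chain_limit:
  assumes step: "\<And>m. \<exists>v. W (Suc m) = W m @ v" and unb: "\<And>k. \<exists>m. k < length (W m)"
  obtains f :: "nat \<Rightarrow> 'a" where "\<And>m i. i < length (W m) \<Longrightarrow> W m ! i = f i"
proof -
  have chain: "\<exists>v. W (m + k) = W m @ v" for m k
  proof (induction k)
    case (Suc k)
    then show ?case using step[of "m + k"] by auto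
  qed simp
  obtain n where n: "\<And>i. i < length (W (n i))" using unb by metis
  have "W m ! i = W (n i) ! i" if "i < length (W m)" for m i
  proof (cases "m \<le> n i")
    case True
    then show ?thesis using chain[of m "n i - m"] that by (auto simp: nth_append)
  next
    case False
    then show ?thesis using chain[of "n i" "m - n i"] n[of i] by (auto simp: nth_append)
  qed
  then show thesis by (rule that)
qed

text \<open>As both lengths are unbounded, every coordinate is reached: the right halves are an
  increasing chain of prefixes, and so are the reversed left halves.\<close>

lemma two_sided_limit:
  assumes L: "\<And>m. \<exists>v. L (Suc m) = v @ L m" "\<And>k. \<exists>m. k < length (L m)"
    and R: "\<And>m. \<exists>v. R (Suc m) = R m @ v" "\<And>k. \<exists>m. k < length (R m)"
  obtains \<omega> :: "int \<Rightarrow> 'a" where "\<And>m. map \<omega> [- int (length (L m))..int (length (R m)) - 1]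
    = L m @ R m"
proof -
  obtain f where f: "\<And>m i. i < length (R m) \<Longrightarrow> R m ! i = f i"
    by (rule prefix_chain_limit[OF R], blast)
  have "\<exists>v. rev (L (Suc m)) = rev (L m) @ v" for m using L(1)[of m] by auto
  moreover have "\<exists>m. k < length (rev (L m))" for k using L(2) by simp
  ultimately obtain g where g: "\<And>m i. i < length (rev (L m)) \<Longrightarrow> rev (L m) ! i = g i"
    by (rule prefix_chain_limit[of "\<lambda>m. rev (L m)"], blast)
  define \<omega> where "\<omega> n = (if n \<ge> 0 then f (nat n) else g (nat (- n - 1)))" for n :: int
  have "map \<omega> [- int (length (L m))..int (length (R m)) - 1] = L m @ R m" for m
  proof (rule nth_equalityI)
    show len: "length (map \<omega> [- int (length (L m))..int (length (R m)) - 1]) = length (L m @ R m)"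
      by simp
    fix i assume "i < length (map \<omega> [- int (length (L m))..int (length (R m)) - 1])"
    then have i: "i < length (L m) + length (R m)" by simp
    then have "map \<omega> [- int (length (L m))..int (length (R m)) - 1] ! i
      = \<omega> (int i - int (length (L m)))"
      by (simp add: nth_upto)
    also have "\<dots> = (L m @ R m) ! i"
    proof (cases "i < length (L m)")
      case True
      then have "nat (- (int i - int (length (L m))) - 1) = length (L m) - Suc i" by linarith
      then have "\<omega> (int i - int (length (L m))) = rev (L m) ! (length (L m) - Suc i)"
        using True g[of "length (L m) - Suc i" m] by (simp add: \<omega>_def)
      also have "\<dots> = L m ! i" using True by (simp add: rev_nth)
      finally show ?thesis using True by (simp add: nth_append)
    next
      case False
      then have "nat (int i - int (length (L m))) = i - length (L m)" by linarith
      then show ?thesis using False i f[of "i - length (L m)" m] by (simp add: \<omega>_def nth_append)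
    qed
    finally show "map \<omega> [- int (length (L m))..int (length (R m)) - 1] ! i = (L m @ R m) ! i" .
  qed
  then show thesis by (rule that)
qed

lemma unbounded_of_infinitely_often_increasing:
  fixes h :: "nat \<Rightarrow> nat"
  assumes mono: "\<And>m. h m \<le> h (Suc m)" and inc: "\<And>m. \<exists>n\<ge>m. h n < h (Suc n)"
  shows "\<exists>m. k < h m"
proof (induction k)
  case 0
  show ?case using inc[of 0] by (metis gr0I not_less_zero)
next
  case (Suc k)
  then obtain m where m: "k < h m" by blast
  obtain n where "n \<ge> m" "h n < h (Suc n)" using inc by blast
  moreover have "h m \<le> h n" using lift_Suc_mono_le[of h, OF mono \<open>n \<ge> m\<close>] .
  ultimately have "Suc k < h (Suc n)" using m by linarith
  then show ?case by blast
qed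

lemma two_sided_sequence_with_decomposition:
  assumes ne: "\<And>a. \<sigma> a \<noteq> []"
    and d: "\<And>m. d m \<in> labels_at \<sigma> (letter_of (d (Suc m)))"
    and p: "\<And>m. \<exists>n\<ge>m. prefix_of (d n) \<noteq> []" and s: "\<And>m. \<exists>n\<ge>m. suffix_of (d n) \<noteq> []"
  obtains \<omega> where "\<And>m. map \<omega> [- int (length (left_word \<sigma> d m))..int (length (right_word \<sigma> d m)) - 1]
      = left_word \<sigma> d m @ right_word \<sigma> d m"
    and "\<And>k. \<exists>m. k < length (left_word \<sigma> d m)" and "\<And>k. \<exists>m. k < length (right_word \<sigma> d m)"
proof -
  have incL: "\<exists>n\<ge>m. length (left_word \<sigma> d n) < length (left_word \<sigma> d (Suc n))" for m
  proof -
    obtain n where n: "n \<ge> Suc m" "prefix_of (d n) \<noteq> []" using p by blast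
    then have "(subst_word \<sigma> ^^ n) (prefix_of (d n)) \<noteq> []" using subst_word_pow_nonempty ne by blast
    then show ?thesis using n(1) by (intro exI[of _ "n - 1"]) (cases n; auto simp: left_word_simps)
  qed
  have incR: "\<exists>n\<ge>m. length (right_word \<sigma> d n) < length (right_word \<sigma> d (Suc n))" for m
  proof -
    obtain n where n: "n \<ge> Suc m" "suffix_of (d n) \<noteq> []" using s by blast
    then have "(subst_word \<sigma> ^^ n) (suffix_of (d n)) \<noteq> []" using subst_word_pow_nonempty ne by blast
    then show ?thesis using n(1) by (intro exI[of _ "n - 1"]) (cases n; auto simp: right_word_simps)
  qed
  have L: "\<exists>m. k < length (left_word \<sigma> d m)" for k
    by (rule unbounded_of_infinitely_often_increasing[OF _ incL]) (simp add: left_word_simps)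
  have R: "\<exists>m. k < length (right_word \<sigma> d m)" for k
    by (rule unbounded_of_infinitely_often_increasing[OF _ incR]) (simp add: right_word_simps)
  obtain \<omega> where "\<And>m. map \<omega> [- int (length (left_word \<sigma> d m))..int (length (right_word \<sigma> d m)) - 1]
      = left_word \<sigma> d m @ right_word \<sigma> d m"
    by (rule two_sided_limit[of "left_word \<sigma> d" "right_word \<sigma> d", OF _ L _ R])
       (simp add: left_word_simps, simp add: right_word_simps, blast)
  then show thesis using L R by (rule that)
qed

lemma decomposition_in_subshift:
  assumes d: "\<And>m. d m \<in> labels_at \<sigma> (letter_of (d (Suc m)))"
    and \<omega>: "\<And>m. map \<omega> [- int (length (left_word \<sigma> d m))..int (length (right_word \<sigma> d m)) - 1]
      = left_word \<sigma> d m @ right_word \<sigma> d m"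
    and window: "\<And>i j. \<exists>m. - int (length (left_word \<sigma> d m)) \<le> i \<and>
      j < int (length (right_word \<sigma> d m))"
  shows "\<omega> \<in> subshift \<sigma>"
  unfolding subshift_def
proof (intro CollectI allI)
  fix i j :: int
  show "\<exists>n a. sublist (map \<omega> [i..j]) ((subst_word \<sigma> ^^ n) [a])"
  proof (cases "i \<le> j")
    case True
    obtain m where m: "- int (length (left_word \<sigma> d m)) \<le> i" "j < int (length (right_word \<sigma> d m))"
      using window by blast
    define l r where "l = - int (length (left_word \<sigma> d m))"
      and "r = int (length (right_word \<sigma> d m)) - 1"
    have lr: "l \<le> i" "j \<le> r" using m by (auto simp: l_def r_def)
    have "[l..r] = [l..i - 1] @ [i..r]" using upto_split1[of l i r] lr True by simp
    moreover have "[i..r] = [i..j] @ [j + 1..r]" using upto_split2[of i j r] lr True by simp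
    ultimately have "map \<omega> [l..r] = map \<omega> [l..i - 1] @ map \<omega> [i..j] @ map \<omega> [j + 1..r]" by simp
    then have "sublist (map \<omega> [i..j]) (map \<omega> [l..r])" unfolding sublist_def by blast
    then have "sublist (map \<omega> [i..j]) ((subst_word \<sigma> ^^ Suc m) [letter_of (d (Suc m))])"
      unfolding l_def r_def \<omega> central_word[of d, OF d] .
    then show ?thesis by blast
  qed simp
qed

lemma prefix_suffix_decomposition_iff:
  "prefix_suffix_decomposition \<sigma> \<omega> d \<longleftrightarrow>
    (\<forall>m. d m \<in> labels_at \<sigma> (letter_of (d (Suc m))) \<and>
      map \<omega> [- int (length (left_word \<sigma> d m))..int (length (right_word \<sigma> d m)) - 1]
        = left_word \<sigma> d m @ right_word \<sigma> d m)"
  by (simp only: prefix_suffix_decomposition_def left_word_def right_word_def labels_at_iff Let_def)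

section \<open>Growth of the cocycle\<close>

lemma shift_in_subshift: "\<omega> \<in> subshift \<sigma> \<Longrightarrow> shift k \<omega> \<in> subshift \<sigma>"
proof -
  assume \<omega>: "\<omega> \<in> subshift \<sigma>"
  have "map (shift k \<omega>) [i..j] = map \<omega> [i + k..j + k]" for i j
    by (rule nth_equalityI) (auto simp: shift_def nth_upto algebra_simps)
  then show ?thesis using \<omega> by (simp add: subshift_def)
qed

lemma shift_shift: "shift (- k) (shift k \<omega>) = \<omega>"
  by (simp add: shift_def)

lemma cocycle_add:
  assumes "k \<le> n"
  shows "cocycle \<gamma> \<omega> n = cocycle \<gamma> \<omega> k + word_value \<gamma> (map \<omega> [k..n - 1])"
proof -
  have split: "word_value \<gamma> (map \<omega> [i..l - 1])
    = word_value \<gamma> (map \<omega> [i..j - 1]) + word_value \<gamma> (map \<omega> [j..l - 1])"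
    if "i \<le> j" "j \<le> l" for i j l
  proof (cases "j \<le> l - 1")
    case True
    then have "[i..l - 1] = [i..j - 1] @ [j..l - 1]" using upto_split1[of i j "l - 1"] that by simp
    then show ?thesis by simp
  next
    case False
    then have "j = l" using that by simp
    then show ?thesis by simp
  qed
  consider "0 \<le> k" | "k < 0" "n < 0" | "k < 0" "0 \<le> n" by linarith
  then show ?thesis
  proof cases
    case 1
    then show ?thesis using assms split[of 0 k n] by (simp add: cocycle_def)
  next
    case 2
    then show ?thesis using assms split[of k n 0] by (simp add: cocycle_def)
  next
    case 3
    then show ?thesis using assms split[of k 0 n] by (simp add: cocycle_def)
  qed
qed

lemma cocycle_shift: "cocycle \<gamma> (shift k \<omega>) n = cocycle \<gamma> \<omega> (n + k) - cocycle \<gamma> \<omega> k"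
proof -
  have "map (shift k \<omega>) [i..j] = map \<omega> [i + k..j + k]" for i j
    by (rule nth_equalityI) (auto simp: shift_def nth_upto algebra_simps)
  note m = this
  show ?thesis
  proof (cases "n \<ge> 0")
    case True
    then show ?thesis using cocycle_add[of k "n + k" \<gamma> \<omega>]
      by (simp add: cocycle_def[of _ "shift k \<omega>"] m diff_add_eq)
  next
    case False
    then show ?thesis using cocycle_add[of "n + k" k \<gamma> \<omega>]
      by (simp add: cocycle_def[of _ "shift k \<omega>"] m diff_add_eq)
  qed
qed

lemma cocycle_in_window:
  assumes \<omega>: "map \<omega> [- int (length L)..int (length R) - 1] = L @ R"
    and n: "- int (length L) \<le> n" "n < int (length R)"
  obtains u b v where "L @ R = u @ b # v" "int (length u) = n + int (length L)"
    "cocycle \<gamma> \<omega> n = word_value \<gamma> u - word_value \<gamma> L"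
proof -
  define l r where "l = - int (length L)" and "r = int (length R) - 1"
  define u where "u = map \<omega> [l..n - 1]"
  have "[l..r] = [l..n - 1] @ [n..r]" using upto_split1[of l n r] n by (simp add: l_def r_def)
  also have "[n..r] = n # [n + 1..r]" using n by (intro upto_rec1) (simp add: r_def)
  finally have "L @ R = u @ \<omega> n # map \<omega> [n + 1..r]"
    using \<omega> by (simp add: u_def l_def r_def)
  moreover have "int (length u) = n + int (length L)" using n by (simp add: u_def l_def)
  moreover have "cocycle \<gamma> \<omega> n = word_value \<gamma> u - word_value \<gamma> L"
  proof -
    have "L = map \<omega> [l..-1]"
    proof -
      have "L = take (length L) (map \<omega> [l..r])" using \<omega> by (simp add: l_def r_def)
      also have "\<dots> = map \<omega> [l..-1]"
        by (rule nth_equalityI) (auto simp: l_def r_def nth_upto)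
      finally show ?thesis .
    qed
    moreover have "cocycle \<gamma> \<omega> 0 = cocycle \<gamma> \<omega> l + word_value \<gamma> (map \<omega> [l..0 - 1])"
      by (rule cocycle_add) (simp add: l_def)
    moreover have "cocycle \<gamma> \<omega> 0 = 0" by (simp add: cocycle_def)
    moreover have "cocycle \<gamma> \<omega> n = cocycle \<gamma> \<omega> l + word_value \<gamma> u"
      unfolding u_def by (rule cocycle_add) (use n in \<open>simp add: l_def\<close>)
    ultimately show ?thesis by (simp add: eq_neg_iff_add_eq_0)
  qed
  ultimately show thesis by (rule that)
qed

text \<open>The cocycle vanishes at 0, so a minimum over a window that contains 0 is at most 0 and
  beats every value outside the window.\<close>

lemma minimal_sequence_shift_of_min:
  assumes fin: "finite W" and "0 \<in> W" and out: "\<And>n. n \<notin> W \<Longrightarrow> 0 \<le> Re (cocycle \<gamma> \<omega> n)"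
  shows "\<exists>k. minimal_sequence \<gamma> (shift k \<omega>)"
proof -
  obtain k where k: "k \<in> W" "\<And>n. n \<in> W \<Longrightarrow> Re (cocycle \<gamma> \<omega> k) \<le> Re (cocycle \<gamma> \<omega> n)"
    using ex_min_if_finite[of "(\<lambda>n. Re (cocycle \<gamma> \<omega> n)) ` W"] fin \<open>0 \<in> W\<close>
    by (metis arg_min_if_finite(1) arg_min_least empty_iff)
  have "Re (cocycle \<gamma> \<omega> k) \<le> 0" using k(2)[OF \<open>0 \<in> W\<close>] by (simp add: cocycle_def)
  then have "Re (cocycle \<gamma> \<omega> k) \<le> Re (cocycle \<gamma> \<omega> n)" for n using k(2)[of n] out[of n] by fastforce
  then show ?thesis by (auto simp: minimal_sequence_def cocycle_shift)
qed

context expanding_substitution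
begin

lemma Re_scaled_pow: "cmod \<beta> ^ n * Re (sgn \<beta> ^ n * t * w) = Re (t * (\<beta> ^ n * w))"
proof -
  have "of_real (cmod \<beta> ^ n) * (sgn \<beta> ^ n * t * w) = (of_real (cmod \<beta>) * sgn \<beta>) ^ n * (t * w)"
    by (simp only: power_mult_distrib of_real_power mult.assoc)
  also have "\<dots> = t * (\<beta> ^ n * w)" by (simp only: polar[symmetric] mult.left_commute)
  finally have eq: "of_real (cmod \<beta> ^ n) * (sgn \<beta> ^ n * t * w) = t * (\<beta> ^ n * w)" .
  have "r * Re x = Re (of_real r * x)" for r x by simp
  then show ?thesis by (simp only: eq)
qed

text \<open>Equality holds in \<open>support_prefix_bound\<close> for the centre, because every label of the
  decomposition is optimal.\<close>

lemma central_support: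
  assumes d: "\<And>m. d m \<in> labels_at \<sigma> (letter_of (d (Suc m)))"
    and opt: "\<And>m. V (letter_of (d (Suc m))) (sgn \<beta> ^ Suc m * t)
      = V' (letter_of (d (Suc m))) (d m) (sgn \<beta> ^ Suc m * t)"
  shows "cmod \<beta> ^ Suc m * V (letter_of (d (Suc m))) (sgn \<beta> ^ Suc m * t)
    = Re (t * word_value \<Gamma> (left_word \<sigma> d m)) + V (letter_of (d 0)) t"
proof -
  have step: "cmod \<beta> * V (letter_of (d (Suc m))) (sgn \<beta> ^ Suc m * t)
    = Re (sgn \<beta> ^ m * t * word_value \<Gamma> (prefix_of (d m))) + V (letter_of (d m))
      (sgn \<beta> ^ m * t)" for m
    unfolding opt using support_recursion[OF d[of m], of "sgn \<beta> ^ m * t"] by (simp add: mult.assoc)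
  show ?thesis
  proof (induction m)
    case 0
    show ?case using step[of 0] by (simp add: left_word_simps)
  next
    case (Suc m)
    have "cmod \<beta> ^ Suc (Suc m) * V (letter_of (d (Suc (Suc m)))) (sgn \<beta> ^ Suc (Suc m) * t)
      = cmod \<beta> ^ Suc m * (cmod \<beta> * V (letter_of (d (Suc (Suc m)))) (sgn \<beta> ^ Suc (Suc m) * t))"
      by (simp only: power_Suc mult.assoc mult.left_commute)
    also have "\<dots> = cmod \<beta> ^ Suc m * Re (sgn \<beta> ^ Suc m * t * word_value \<Gamma> (prefix_of (d (Suc m))))
        + cmod \<beta> ^ Suc m * V (letter_of (d (Suc m))) (sgn \<beta> ^ Suc m * t)"
      unfolding step by (rule distrib_left)
    also have "\<dots> = Re (t * word_value \<Gamma> (left_word \<sigma> d (Suc m))) + V (letter_of (d 0)) t"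
      unfolding Re_scaled_pow Suc.IH left_word_simps word_value_simps word_value_subst_word_pow
      by (simp only: distrib_left plus_complex.sel add.assoc)
    finally show ?case .
  qed
qed

text \<open>A position inside the block of the label \<open>l\<close>: one step with \<open>l\<close> fixed, then the general
  bound for the remaining levels.\<close>

lemma off_center_support:
  assumes l: "l \<in> labels_at \<sigma> a" and u: "u = (subst_word \<sigma> ^^ m) (prefix_of l) @ u'"
    and b: "(subst_word \<sigma> ^^ m) [letter_of l] = u' @ b # v"
  shows "cmod \<beta> ^ Suc m * V' a l (sgn \<beta> ^ Suc m * t) \<le> Re (t * word_value \<Gamma> u) + V b t"
proof -
  have "cmod \<beta> ^ Suc m * V' a l (sgn \<beta> ^ Suc m * t)
    = cmod \<beta> ^ m * (cmod \<beta> * V' a l (sgn \<beta> * (sgn \<beta> ^ m * t)))"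
    by (simp only: power_Suc mult.assoc mult.left_commute)
  also have "\<dots> = cmod \<beta> ^ m * Re (sgn \<beta> ^ m * t * word_value \<Gamma> (prefix_of l))
      + cmod \<beta> ^ m * V (letter_of l) (sgn \<beta> ^ m * t)"
    unfolding support_recursion[OF l] by (rule distrib_left)
  also have "\<dots> \<le> Re (t * word_value \<Gamma> ((subst_word \<sigma> ^^ m) (prefix_of l)))
    + (Re (t * word_value \<Gamma> u') + V b t)"
    unfolding Re_scaled_pow word_value_subst_word_pow
    by (intro add_left_mono support_prefix_bound[OF b])
  finally show ?thesis unfolding u word_value_simps
    by (simp only: distrib_left plus_complex.sel add.assoc)
qed

text \<open>A position that enters the window at level \<open>m + 1\<close> first leaves the optimal path at the
  label of this level. Comparing it with the centre costs the scaled gap, up to the bounded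
  difference of the support functions of two letters.\<close>

lemma cocycle_nonnegative_outside_window:
  assumes d: "\<And>m. d m \<in> labels_at \<sigma> (letter_of (d (Suc m)))"
    and opt: "\<And>m. V (letter_of (d (Suc m))) (sgn \<beta> ^ Suc m * \<tau>)
      = V' (letter_of (d (Suc m))) (d m) (sgn \<beta> ^ Suc m * \<tau>)"
    and urp: "unique_representation \<sigma> \<beta> \<Gamma>" and good: "good_direction \<sigma> \<beta> \<Gamma> \<tau>"
    and z: "\<tau> = sgn z"
    and \<omega>: "\<And>m. map \<omega> [- int (length (left_word \<sigma> d m))..int (length (right_word \<sigma> d m)) - 1]
      = left_word \<sigma> d m @ right_word \<sigma> d m"
    and window: "\<And>m n. \<exists>k\<ge>m. - int (length (left_word \<sigma> d k)) \<le> n \<and>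
      n < int (length (right_word \<sigma> d k))"
  obtains m0 where "\<And>n. n \<notin> {- int (length (left_word \<sigma> d m0))..<int (length (right_word \<sigma> d m0))} \<Longrightarrow>
    0 \<le> Re (cocycle (z *s \<Gamma>) \<omega> n)"
proof -
  define W where "W m = {- int (length (left_word \<sigma> d m))..<int (length (right_word \<sigma> d m))}" for m
  \<comment> \<open>The gap has to outweigh the difference of the support terms of the end letter and the centre.\<close>
  define C where "C = Max (range (\<lambda>b. V b \<tau>)) - V (letter_of (d 0)) \<tau>"
  have C: "V b \<tau> - V (letter_of (d 0)) \<tau> \<le> C" for b by (simp add: C_def)
  obtain m0 where m0: "\<And>m l. m \<ge> m0 \<Longrightarrow> l \<in> labels_at \<sigma> (letter_of (d (Suc m))) \<Longrightarrow> l \<noteq> d m \<Longrightarrow>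
    C \<le> cmod \<beta> ^ Suc m * (V' (letter_of (d (Suc m))) l (sgn \<beta> ^ Suc m * \<tau>)
      - V (letter_of (d (Suc m))) (sgn \<beta> ^ Suc m * \<tau>))"
    using good_direction_gap[of \<tau> d C, OF urp good d opt] unfolding eventually_sequentially by blast
  have "0 \<le> Re (cocycle (z *s \<Gamma>) \<omega> n)" if n: "n \<notin> W m0" for n
  proof -
    \<comment> \<open>The level at which the position \<open>n\<close> enters the central block.\<close>
    define M where "M = (LEAST k. k \<ge> m0 \<and> n \<in> W k)"
    have ex: "\<exists>k. k \<ge> m0 \<and> n \<in> W k" using window[of m0 n] by (auto simp: W_def)
    have M: "M \<ge> m0" "n \<in> W M" using LeastI_ex[OF ex] by (auto simp: M_def)
    then have "M \<noteq> m0" using n by metis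
    then obtain m where m: "M = Suc m" "m \<ge> m0" using M(1) by (cases M) auto
    have nW: "n \<notin> W m" using not_less_Least[of m "\<lambda>k. k \<ge> m0 \<and> n \<in> W k"] m
      by (simp add: M_def[symmetric])
    define L where "L = left_word \<sigma> d (Suc m)"
    define a where "a = letter_of (d (Suc (Suc m)))"
    define t where "t = sgn \<beta> ^ Suc (Suc m) * \<tau>"
    have cw: "L @ right_word \<sigma> d (Suc m) = (subst_word \<sigma> ^^ Suc m) (\<sigma> a)"
      unfolding L_def a_def central_word[of d, OF d] funpow_Suc_right[of "Suc m"] by simp
    have "- int (length L) \<le> n" "n < int (length (right_word \<sigma> d (Suc m)))"
      using M(2) by (auto simp: m W_def L_def)
    then obtain u b v where u: "L @ right_word \<sigma> d (Suc m) = u @ b # v"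
      "int (length u) = n + int (length L)"
      "cocycle (z *s \<Gamma>) \<omega> n = word_value (z *s \<Gamma>) u - word_value (z *s \<Gamma>) L"
      by (rule cocycle_in_window[OF \<omega>[of "Suc m", folded L_def]])
    from u(1) obtain p c s u' v' where sp: "\<sigma> a = p @ c # s"
      "(subst_word \<sigma> ^^ Suc m) [c] = u' @ b # v'"
      "u = (subst_word \<sigma> ^^ Suc m) p @ u'"
      unfolding cw by (rule subst_word_pow_split_at_letter)
    define l where "l = (p, c, s)"
    have l: "l \<in> labels_at \<sigma> a" using sp(1) by (simp add: l_def labels_at_iff)
    \<comment> \<open>Otherwise \<open>n\<close> would already lie in the window of level \<open>m\<close>.\<close>
    have "l \<noteq> d (Suc m)"
    proof
      assume eq: "l = d (Suc m)"
      then have p: "p = prefix_of (d (Suc m))" and c: "c = letter_of (d (Suc m))"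
        by (auto simp: l_def dest: sym)
      have "length u' < length ((subst_word \<sigma> ^^ Suc m) [c])" unfolding sp(2) by simp
      also have "\<dots> = length (left_word \<sigma> d m) + length (right_word \<sigma> d m)"
        unfolding c central_word[of d, OF d, symmetric] by simp
      finally have "length u' < length (left_word \<sigma> d m) + length (right_word \<sigma> d m)" .
      moreover have "int (length u') = n + int (length (left_word \<sigma> d m))"
        using u(2) by (simp add: sp(3) L_def left_word_simps p del: funpow.simps)
      ultimately show False using nW by (auto simp: W_def)
    qed
    then have "C \<le> cmod \<beta> ^ Suc (Suc m) * (V' a l t - V a t)"
      unfolding a_def t_def using m(2) l by (intro m0) (auto simp: a_def)
    moreover have "cmod \<beta> ^ Suc (Suc m) * V' a l t \<le> Re (\<tau> * word_value \<Gamma> u) + V b \<tau>"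
      unfolding t_def using sp by (intro off_center_support[OF l]) (auto simp: l_def)
    moreover have "cmod \<beta> ^ Suc (Suc m) * V a t = Re (\<tau> * word_value \<Gamma> L) + V (letter_of (d 0)) \<tau>"
      unfolding a_def t_def L_def by (rule central_support[OF d opt])
    ultimately have "0 \<le> Re (\<tau> * word_value \<Gamma> u) - Re (\<tau> * word_value \<Gamma> L)"
      using C[of b] unfolding right_diff_distrib by linarith
    then have "0 \<le> Re (\<tau> * (word_value \<Gamma> u - word_value \<Gamma> L))"
      by (simp only: right_diff_distrib minus_complex.sel)
    then have "0 \<le> cmod z * Re (\<tau> * (word_value \<Gamma> u - word_value \<Gamma> L))"
      by (rule mult_nonneg_nonneg[OF norm_ge_zero])
    also have "r * Re x = Re (of_real r * x)" for r x by simp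
    also have "of_real (cmod z) * (\<tau> * (word_value \<Gamma> u - word_value \<Gamma> L)) = cocycle (z *s \<Gamma>) \<omega> n"
      unfolding u(3) word_value_scale z by (cases "z = 0") (simp_all add: sgn_eq right_diff_distrib)
    finally show ?thesis .
  qed
  then show thesis using that[of m0] by (simp add: W_def)
qed

end

section \<open>Dense orbits of irrational rotations\<close>

text \<open>Kronecker's approximation theorem, aimed at the midpoint of the arc from \<open>y\<close> to \<open>y cis \<epsilon>\<close>
  so that the error keeps the orbit point strictly to the right of \<open>y\<close>.\<close>

lemma rotation_orbit_dense_from_right:
  fixes w x y :: complex
  assumes w: "cmod w = 1" "\<forall>n\<ge>1. w ^ n \<noteq> 1" and x: "cmod x = 1" and y: "cmod y = 1" and "0 < \<epsilon>"
  obtains n \<theta> where "0 < \<theta>" "\<theta> < \<epsilon>" "w ^ n * x = y * cis \<theta>"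
proof -
  define \<phi> where "\<phi> = Arg w / (2 * pi)"
  define \<alpha> where "\<alpha> = Arg (y / x)"
  have wc: "w = cis (2 * pi * \<phi>)" using w(1) cis_Arg[of w]
    by (cases "w = 0") (auto simp: \<phi>_def sgn_eq)
  have yx: "y = x * cis \<alpha>"
    using x y cis_Arg[of "y / x"] by (cases "y / x = 0") (auto simp: \<alpha>_def sgn_eq norm_divide)
  have pow: "w ^ n = cis (2 * pi * (real n * \<phi>))" for n
    by (simp add: wc Complex.DeMoivre mult.left_commute)
  have irr: "\<phi> \<notin> \<rat>"
  proof
    assume "\<phi> \<in> \<rat>"
    then obtain a b where ab: "\<phi> = of_int a / of_int b" "b > 0" by (meson Rats_cases')
    then have "real (nat b) * \<phi> = of_int a" by simp
    then have "w ^ nat b = 1" by (simp only: pow) (simp add: cis_multiple_2pi)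
    with ab w(2) show False by (metis One_nat_def Suc_leI zero_less_nat_eq)
  qed
  obtain h k where k: "k > 0"
    and hk: "\<bar>of_int k * \<phi> - of_int h - (\<alpha> + \<epsilon> / 2) / (2 * pi)\<bar> < \<epsilon> / (4 * pi)"
    by (rule sequence_of_fractional_parts_is_dense[OF irr, of "\<epsilon> / (4 * pi)"
      "(\<alpha> + \<epsilon> / 2) / (2 * pi)"])
      (use \<open>0 < \<epsilon>\<close> in auto)
  define \<theta> where "\<theta> = 2 * pi * (of_int k * \<phi>) - 2 * pi * of_int h - \<alpha>"
  have "\<bar>\<theta> - \<epsilon> / 2\<bar> = 2 * pi * \<bar>of_int k * \<phi> - of_int h - (\<alpha> + \<epsilon> / 2) / (2 * pi)\<bar>"
  proof -
    have "\<theta> - \<epsilon> / 2 = 2 * pi * (of_int k * \<phi> - of_int h - (\<alpha> + \<epsilon> / 2) / (2 * pi))"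
      by (simp add: \<theta>_def right_diff_distrib)
    then show ?thesis by (simp add: abs_mult)
  qed
  also have "\<dots> < 2 * pi * (\<epsilon> / (4 * pi))"
    using hk by (intro mult_strict_left_mono) auto
  also have "\<dots> = \<epsilon> / 2" by simp
  finally have "\<bar>\<theta> - \<epsilon> / 2\<bar> < \<epsilon> / 2" .
  then have \<theta>: "0 < \<theta>" "\<theta> < \<epsilon>" by linarith+
  have "w ^ nat k = cis (2 * pi * of_int h + (\<alpha> + \<theta>))"
    using k by (simp add: pow \<theta>_def)
  also have "\<dots> = cis \<alpha> * cis \<theta>"
    by (metis cis_mult cis_multiple_2pi Ints_of_int mult_1)
  finally have "w ^ nat k * x = y * cis \<theta>" by (simp add: yx)
  with \<theta> show thesis by (rule that)
qed

section \<open>Recurrence of nonempty prefixes and suffixes\<close>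

context expanding_substitution
begin

text \<open>A letter with a single label sequence is fixed by \<open>\<sigma>\<close>; primitivity makes it the only
  letter, and then the eigenvalue is 1.\<close>

lemma several_label_seqs:
  assumes prim: "primitive_subst \<sigma>" and "\<Gamma> \<noteq> 0"
  shows "label_seqs \<sigma> c \<noteq> {\<lambda>_. l}"
proof
  assume one: "label_seqs \<sigma> c = {\<lambda>_. l}"
  have all: "l' = l" if "l' \<in> labels_at \<sigma> c" for l'
    using label_seqs_from_nonempty[OF that] one by (auto simp: label_seqs_from_def)
  obtain x w where xw: "\<sigma> c = x # w" using nonerasing[of c] by (cases "\<sigma> c") auto
  then have lx: "l = ([], x, w)" using all[of "([], x, w)"] by (simp add: labels_at_iff)
  have w: "w = []"
  proof (cases w)
    case (Cons y w')
    then have "([x], y, w') \<in> labels_at \<sigma> c" using xw by (simp add: labels_at_iff)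
    then show ?thesis using all lx by blast
  qed simp
  have "(\<lambda>_. l) \<in> label_seqs \<sigma> c" using one by simp
  then have "l \<in> labels_at \<sigma> x" using lx by (simp add: label_seqs_def)
  then have "\<sigma> x = [x]" using lx w by (simp add: labels_at_iff)
  have pow: "(subst_word \<sigma> ^^ n) [x] = [x]" for n by (induction n) (auto simp: \<open>\<sigma> x = [x]\<close>)
  obtain n where "\<forall>a b. b \<in> set ((subst_word \<sigma> ^^ n) [a])"
    using prim unfolding primitive_subst_def by blast
  then have "b \<in> set ((subst_word \<sigma> ^^ n) [x])" for b by blast
  then have "\<And>b. b = x" by (simp add: pow)
  then have "\<Gamma> $ x \<noteq> 0" using \<open>\<Gamma> \<noteq> 0\<close> by (metis vec_eq_iff zero_index)
  moreover have "\<Gamma> $ x = \<beta> * \<Gamma> $ x" using eigen[of x] \<open>\<sigma> x = [x]\<close> by simp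
  ultimately have "\<beta> = 1" by simp
  then show False using expanding by simp
qed

text \<open>For a constant label \<open>l\<close> with represented point \<open>z\<close>, the function \<open>h(t) = v\<^sub>c(t) - Re(t z)\<close>
  is divided by \<open>\<bar>\<beta>\<bar>\<close> at each step of the rotation. It tends to 0 along a dense orbit, hence
  vanishes, and every supporting half-plane of the fractal has \<open>z\<close> on its boundary: the fractal
  is the point \<open>z\<close>, and all label sequences represent it.\<close>

lemma not_eventually_constant:
  assumes prim: "primitive_subst \<sigma>" and "\<Gamma> \<noteq> 0" and urp: "unique_representation \<sigma> \<beta> \<Gamma>"
    and irr: "\<forall>n\<ge>1. sgn \<beta> ^ n \<noteq> 1" and \<tau>: "cmod \<tau> = 1"
    and d: "\<And>m. d m \<in> labels_at \<sigma> (letter_of (d (Suc m)))"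
    and opt: "\<And>m. V (letter_of (d (Suc m))) (sgn \<beta> ^ Suc m * \<tau>)
      = V' (letter_of (d (Suc m))) (d m) (sgn \<beta> ^ Suc m * \<tau>)"
    and const: "\<And>m. m \<ge> m0 \<Longrightarrow> d m = l"
  shows False
proof -
  define c where "c = letter_of l"
  define x where "x = (\<lambda>_::nat. l)"
  define z where "z = represented \<beta> \<Gamma> x"
  have l: "l \<in> labels_at \<sigma> c" using d[of m0] const by (simp add: c_def)
  have x: "x \<in> label_seqs \<sigma> c" using l by (simp add: x_def label_seqs_def c_def)
  have zF: "z \<in> fractal \<sigma> \<beta> \<Gamma> c" using x by (simp add: z_def fractal_def)
  have zfix: "\<beta> * z = word_value \<Gamma> (prefix_of l) + z"
  proof -
    have "z = (word_value \<Gamma> (prefix_of l) + z) / \<beta>"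
      using represented_Cons[OF x] unfolding z_def x_def .
    then have "\<beta> * z = \<beta> * ((word_value \<Gamma> (prefix_of l) + z) / \<beta>)" by (rule arg_cong)
    then show ?thesis using \<beta>_nz by simp
  qed
  \<comment> \<open>\<open>h t \<le> 0\<close>, with equality exactly if \<open>z\<close> is extreme for the direction \<open>t\<close>.\<close>
  define h where "h t = V c t - Re (t * z)" for t
  have h_step: "h (sgn \<beta> ^ Suc m * \<tau>) = h (sgn \<beta> ^ m * \<tau>) / cmod \<beta>" if "m \<ge> m0" for m
  proof -
    define t where "t = sgn \<beta> ^ m * \<tau>"
    have "cmod \<beta> * V c (sgn \<beta> * t) = Re (t * word_value \<Gamma> (prefix_of l)) + V c t"
      using support_recursion[OF l, of t] opt[of m] const that by (simp add: t_def mult.assoc c_def)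
    moreover have "cmod \<beta> * Re (sgn \<beta> * t * z) = Re (t * (\<beta> * z))"
      using Re_scaled_pow[of 1 t z] by simp
    ultimately have "cmod \<beta> * h (sgn \<beta> * t) = h t"
      unfolding h_def zfix right_diff_distrib distrib_left plus_complex.sel by linarith
    then show ?thesis using \<beta>_nz by (simp add: t_def field_simps)
  qed
  have h_pow: "h (sgn \<beta> ^ (m0 + k) * \<tau>) = h (sgn \<beta> ^ m0 * \<tau>) * (1 / cmod \<beta>) ^ k" for k
    by (induction k) (use h_step in simp_all)
  have "(\<lambda>k. h (sgn \<beta> ^ m0 * \<tau>) * (1 / cmod \<beta>) ^ k) \<longlonglongrightarrow> h (sgn \<beta> ^ m0 * \<tau>) * 0"
    using expanding by (intro tendsto_intros LIMSEQ_power_zero) (simp add: divide_less_eq)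
  then have h_lim: "(\<lambda>k. h (sgn \<beta> ^ (m0 + k) * \<tau>)) \<longlonglongrightarrow> 0" by (simp add: h_pow)
  have h0: "h t = 0" if t: "cmod t = 1" for t
  proof -
    have "\<exists>n \<theta>. n \<ge> k \<and> 0 < \<theta> \<and> \<theta> < 1 / real (Suc k) \<and> sgn \<beta> ^ (m0 + n) * \<tau> = t * cis \<theta>" for k
    proof -
      have "cmod (sgn \<beta> ^ (m0 + k) * \<tau>) = 1" by (simp add: norm_mult norm_power sgn_\<beta> \<tau>)
      then obtain n \<theta> where "0 < \<theta>" "\<theta> < 1 / real (Suc k)"
        "sgn \<beta> ^ n * (sgn \<beta> ^ (m0 + k) * \<tau>) = t * cis \<theta>"
        by (rule rotation_orbit_dense_from_right[OF sgn_\<beta> irr _ t, of _ "1 / real (Suc k)"])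
          simp_all
      then show ?thesis
        by (intro exI[of _ "k + n"] exI[of _ \<theta>]) (simp add: power_add mult.assoc mult.left_commute)
    qed
    then obtain n \<theta> where n: "\<And>k. n k \<ge> k" and \<theta>: "\<And>k. 0 < \<theta> k" "\<And>k. \<theta> k < 1 / real (Suc k)"
      and eq: "\<And>k. sgn \<beta> ^ (m0 + n k) * \<tau> = t * cis (\<theta> k)" by metis
    have "\<theta> \<longlonglongrightarrow> 0"
      by (rule tendsto_sandwich[of "\<lambda>_. 0" _ _ "\<lambda>k. 1 / real (Suc k)"])
         (use \<theta> LIMSEQ_inverse_real_of_nat in
           \<open>auto intro!: always_eventually less_imp_le simp: inverse_eq_divide\<close>)
    then have "(\<lambda>k. t * cis (\<theta> k)) \<longlonglongrightarrow> t * cis 0" by (intro tendsto_intros)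
    then have lim: "(\<lambda>k. t * cis (\<theta> k)) \<longlonglongrightarrow> t" by simp
    have "(\<lambda>k. h (t * cis (\<theta> k))) \<longlonglongrightarrow> h t"
      unfolding h_def by (intro tendsto_intros tendsto_min_re[OF compact_fractal fractal_nonempty]
        lim)
    moreover have "filterlim n sequentially sequentially"
      by (rule filterlim_at_top_mono[OF filterlim_ident]) (simp add: n)
    then have "(\<lambda>k. h (t * cis (\<theta> k))) \<longlonglongrightarrow> 0"
      unfolding eq[symmetric] by (rule filterlim_compose[OF h_lim])
    ultimately show ?thesis by (rule LIMSEQ_unique)
  qed
  have single: "y = z" if y: "y \<in> fractal \<sigma> \<beta> \<Gamma> c" for y
  proof (rule ccontr)
    assume "y \<noteq> z"
    \<comment> \<open>The direction in which \<open>y\<close> lies furthest beyond \<open>z\<close>.\<close>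
    define t where "t = - sgn (cnj (y - z))"
    have "cmod t = 1" using \<open>y \<noteq> z\<close> by (simp add: t_def norm_sgn del: complex_cnj_diff)
    then have "Re (t * z) \<le> Re (t * y)" using h0[of t] min_re_le[OF compact_fractal y, of t]
      by (simp add: h_def)
    then have "0 \<le> Re (t * (y - z))"
      by (simp only: right_diff_distrib minus_complex.sel diff_ge_0_iff_ge)
    also have "t * (y - z) = - of_real (cmod (y - z))"
    proof -
      have "cnj (y - z) * (y - z) = of_real (cmod (y - z)) * of_real (cmod (y - z))"
        using complex_norm_square[of "y - z"]
        by (simp only: of_real_mult power2_eq_square mult.commute)
      then show ?thesis using \<open>y \<noteq> z\<close>
        by (simp add: t_def sgn_eq field_simps del: complex_cnj_diff)
    qed
    finally show False using \<open>y \<noteq> z\<close> by simp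
  qed
  have "\<exists>\<tau>\<in>sphere 0 1. Re (\<tau> * z) = V c \<tau>" using h0[of 1] by (intro bexI[of _ 1]) (auto simp: h_def)
  then have "\<exists>!x. x \<in> label_seqs \<sigma> c \<and> represented \<beta> \<Gamma> x = z"
    using urp zF unfolding unique_representation_def by blast
  then have "y = x" if "y \<in> label_seqs \<sigma> c" for y
    using that x single[of "represented \<beta> \<Gamma> y"] by (auto simp: z_def fractal_def)
  then have "label_seqs \<sigma> c = {x}" using x by blast
  then have "label_seqs \<sigma> c = {\<lambda>_. l}" unfolding x_def .
  then show False using several_label_seqs[OF prim \<open>\<Gamma> \<noteq> 0\<close>] by blast
qed

end

lemma primitive_nonerasing:
  assumes "primitive_subst \<sigma>"
  shows "\<sigma> a \<noteq> []"
proof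
  assume "\<sigma> a = []"
  obtain n where n: "n \<ge> 1" "\<And>a b. b \<in> set ((subst_word \<sigma> ^^ n) [a])"
    using assms by (auto simp: primitive_subst_def)
  then obtain k where "n = Suc k" by (cases n) auto
  then have "(subst_word \<sigma> ^^ n) [a] = []" using \<open>\<sigma> a = []\<close>
    by (simp add: funpow_Suc_right del: funpow.simps)
  then show False using n(2)[of a a] by simp
qed

text \<open>The inclusions \<open>\<alpha> Q(a) \<subseteq> Q(f(a))\<close> iterate to \<open>\<alpha>\<^sup>k Q(c\<^sub>m\<^sub>+\<^sub>k) \<subseteq> Q(c\<^sub>m)\<close>, and for large \<open>k\<close>
  the left-hand side lies in the cell at 0.\<close>

lemma nested_cells_letters_constant:
  fixes Q :: "'a \<Rightarrow> real set" and \<alpha> :: real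
  assumes disj: "disjoint_family Q" and ne: "\<And>a. Q a \<noteq> {}" and bd: "\<And>a. Q a \<subseteq> {0..<1}"
    and first: "0 < \<epsilon>" "{0..<\<epsilon>} \<subseteq> Q a0" and \<alpha>: "0 < \<alpha>" "\<alpha> < 1"
    and nest: "\<And>a x. x \<in> Q a \<Longrightarrow> \<alpha> * x \<in> Q (f a)"
    and c: "\<And>m. m \<ge> m0 \<Longrightarrow> c m = f (c (Suc m))" and "m \<ge> m0"
  shows "c m = a0"
proof -
  have pow: "\<alpha> ^ k * x \<in> Q (c m)" if "m \<ge> m0" "x \<in> Q (c (m + k))" for k m x
    using that
  proof (induction k arbitrary: m)
    case (Suc k)
    then have "\<alpha> ^ k * x \<in> Q (c (Suc m))" by simp
    then have "\<alpha> * (\<alpha> ^ k * x) \<in> Q (f (c (Suc m)))" by (rule nest)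
    also have "f (c (Suc m)) = c m" using c[OF Suc.prems(1)] by (rule sym)
    finally show ?case by (simp add: mult.assoc)
  qed simp
  obtain k where k: "\<alpha> ^ k < \<epsilon>" using real_arch_pow_inv[OF first(1) \<alpha>(2)] by blast
  obtain x where x: "x \<in> Q (c (m + k))" using ne by blast
  then have "0 \<le> x" "x < 1" using bd by force+
  then have "\<alpha> ^ k * x \<le> \<alpha> ^ k" "0 \<le> \<alpha> ^ k * x" using \<alpha> by (auto intro: mult_left_le)
  then have "\<alpha> ^ k * x \<in> Q a0" using k first(2) by force
  moreover have "\<alpha> ^ k * x \<in> Q (c m)" using pow[OF \<open>m \<ge> m0\<close> x] .
  ultimately show ?thesis using disj by (metis IntI disjoint_family_onD empty_iff UNIV_I)
qed

lemma cell_at_zero: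
  assumes "\<And>a. \<exists>l u. Q a = {l..<u}" and un: "(\<Union>a. Q a) = {0..<1::real}"
  obtains a0 \<epsilon> where "0 < \<epsilon>" "{0..<\<epsilon>} \<subseteq> Q a0"
proof -
  have "0 \<in> (\<Union>a. Q a)" unfolding un by simp
  then obtain a0 where a0: "0 \<in> Q a0" by blast
  obtain l u where "Q a0 = {l..<u}" using assms(1) by blast
  then show thesis using a0 that[of u a0] by auto
qed

lemma first_letter_cell:
  assumes "associated_substitution T P \<alpha> \<sigma>" "\<sigma> a \<noteq> []" "x \<in> P a"
  shows "\<alpha> * x \<in> P (hd (\<sigma> a))"
proof -
  have "(T ^^ 0) ` (\<lambda>t. \<alpha> * t) ` P a \<subseteq> P (\<sigma> a ! 0)"
    using assms(1,2) unfolding associated_substitution_def by blast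
  then show ?thesis using assms(2,3) by (auto simp: hd_conv_nth)
qed

text \<open>The last point of the excursion of \<open>\<alpha> t\<close> before its return is mapped by \<open>T\<close> to the first
  return \<open>\<alpha> T(t)\<close>. So last letters are governed by the image intervals as first letters are by
  the exchanged ones.\<close>

lemma last_letter_cell:
  assumes iem: "is_iem T P \<delta>" and ss: "self_similar T \<alpha>" and as: "associated_substitution T P \<alpha> \<sigma>"
    and ne: "\<sigma> a \<noteq> []" and x: "x \<in> T ` P a"
  shows "\<alpha> * x \<in> T ` P (last (\<sigma> a))"
proof -
  obtain t where t: "t \<in> P a" "x = T t" using x by blast
  have "t \<in> {0..<1}" using iem t(1) unfolding is_iem_def by blast
  moreover have \<alpha>: "0 < \<alpha>" using ss by (simp add: self_similar_def)
  ultimately have "\<alpha> * t \<in> {0..<\<alpha>}" by simp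
  then have "first_return_map T {0..<\<alpha>} (\<alpha> * t) = \<alpha> * T (\<alpha> * t / \<alpha>)" using ss
    by (simp add: self_similar_def)
  moreover have "first_return_time T {0..<\<alpha>} (\<alpha> * t) = length (\<sigma> a)"
    using as t(1) unfolding associated_substitution_def by blast
  ultimately have "(T ^^ length (\<sigma> a)) (\<alpha> * t) = \<alpha> * x" using \<alpha> t(2)
    by (simp add: first_return_map_def)
  moreover have "length (\<sigma> a) = Suc (length (\<sigma> a) - 1)" using ne by simp
  ultimately have "T ((T ^^ (length (\<sigma> a) - 1)) (\<alpha> * t)) = \<alpha> * x" by (metis funpow.simps(2) o_apply)
  moreover have "(T ^^ (length (\<sigma> a) - 1)) (\<alpha> * t) \<in> P (\<sigma> a ! (length (\<sigma> a) - 1))"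
  proof -
    have "length (\<sigma> a) - 1 < length (\<sigma> a)" using ne by simp
    then have "(T ^^ (length (\<sigma> a) - 1)) ` (\<lambda>t. \<alpha> * t) ` P a \<subseteq> P (\<sigma> a ! (length (\<sigma> a) - 1))"
      using as unfolding associated_substitution_def by blast
    then show ?thesis using t(1) by blast
  qed
  ultimately show ?thesis using ne by (metis image_eqI last_conv_nth)
qed

text \<open>The two letters are those whose exchanged interval, respectively image interval, contains
  0.\<close>

lemma iem_letters_eventually_constant:
  assumes iem: "is_iem T P \<delta>" and ss: "self_similar T \<alpha>" and as: "associated_substitution T P \<alpha> \<sigma>"
    and ne: "\<And>a. \<sigma> a \<noteq> []"
  obtains a0 b0 where
    "\<And>c m0 m. (\<And>m. m \<ge> m0 \<Longrightarrow> c m = hd (\<sigma> (c (Suc m)))) \<Longrightarrow> (m::nat) \<ge> m0 \<Longrightarrow> c m = a0"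
    "\<And>c m0 m. (\<And>m. m \<ge> m0 \<Longrightarrow> c m = last (\<sigma> (c (Suc m)))) \<Longrightarrow> (m::nat) \<ge> m0 \<Longrightarrow> c m = b0"
proof -
  have P: "\<And>a. \<exists>l u. l < u \<and> P a = {l..<u}" "disjoint_family P" "(\<Union>a. P a) = {0..<1}"
    and T: "bij_betw T {0..<1} {0..<1}" "\<And>a t. t \<in> P a \<Longrightarrow> T t = t + \<delta> $ a"
    using iem by (auto simp: is_iem_def)
  have \<alpha>: "0 < \<alpha>" "\<alpha> < 1" using ss by (auto simp: self_similar_def)
  have Pne: "P a \<noteq> {}" for a using P(1)[of a] by auto
  have Psub: "P a \<subseteq> {0..<1}" for a using P(3) by blast
  obtain a0 \<epsilon> where a0: "0 < \<epsilon>" "{0..<\<epsilon>} \<subseteq> P a0"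
    by (rule cell_at_zero[OF _ P(3)]) (use P(1) in blast)+
  have TP: "\<exists>l u. T ` P a = {l..<u}" for a
  proof -
    obtain l u where lu: "P a = {l..<u}" using P(1) by blast
    have "T ` P a = (\<lambda>t. t + \<delta> $ a) ` P a" by (intro image_cong refl T(2))
    then show ?thesis unfolding lu by (auto simp: image_add_atLeastLessThan')
  qed
  have Tun: "(\<Union>a. T ` P a) = {0..<1}" using T(1) unfolding image_UN[symmetric] P(3)
    by (simp add: bij_betw_def)
  have Tdisj: "disjoint_family (\<lambda>a. T ` P a)"
  proof -
    have "T ` P a \<inter> T ` P b = {}" if "a \<noteq> b" for a b
    proof -
      have "T ` P a \<inter> T ` P b = T ` (P a \<inter> P b)"
        using T(1) Psub by (intro inj_on_image_Int[symmetric, of _ "{0..<1}"])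
          (auto simp: bij_betw_def)
      then show ?thesis using P(2) that by (simp add: disjoint_family_on_def)
    qed
    then show ?thesis by (simp add: disjoint_family_on_def)
  qed
  have TPsub: "T ` P a \<subseteq> {0..<1}" for a using Tun by blast
  obtain b0 \<epsilon>' where b0: "0 < \<epsilon>'" "{0..<\<epsilon>'} \<subseteq> T ` P b0"
    by (rule cell_at_zero[OF TP Tun]) blast
  show thesis
  proof
    show "c m = a0" if "\<And>m. m \<ge> m0 \<Longrightarrow> c m = hd (\<sigma> (c (Suc m)))" "m \<ge> m0" for c and m0 m :: nat
      by (rule nested_cells_letters_constant[where f = "\<lambda>a. hd (\<sigma> a)" and c = c, OF P(2) Pne Psub a0
        \<alpha> first_letter_cell[OF as ne] that])
    show "c m = b0" if "\<And>m. m \<ge> m0 \<Longrightarrow> c m = last (\<sigma> (c (Suc m)))" "m \<ge> m0" for c and m0 m :: nat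
      by (rule nested_cells_letters_constant[where Q = "\<lambda>a. T ` P a" and f = "\<lambda>a. last (\<sigma> a)" and c
        = c,
            OF Tdisj _ TPsub b0 \<alpha> last_letter_cell[OF iem ss as ne] that]) (use Pne in simp)
  qed
qed

text \<open>The map \<open>H\<close> enters through the optimality of the labels: \<open>d\<close> is any backward path of labels
  that realize the support values in the directions \<open>(sgn \<beta>)\<^sup>m sgn z\<close>.\<close>

lemma (in expanding_substitution) minimal_sequence_of_optimal_labels:
  assumes iem: "is_iem T P \<delta>" "self_similar T \<alpha>" "associated_substitution T P \<alpha> \<sigma>"
    and prim: "primitive_subst \<sigma>" and \<Gamma>: "\<Gamma> \<noteq> 0"
    and irr: "\<forall>n\<ge>1. sgn \<beta> ^ n \<noteq> 1"
    and urp: "unique_representation \<sigma> \<beta> \<Gamma>" and good: "good_direction \<sigma> \<beta> \<Gamma> (sgn z)"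
    and d: "\<And>m. d m \<in> labels_at \<sigma> (letter_of (d (Suc m)))"
    and opt: "\<And>m. V (letter_of (d (Suc m))) (sgn \<beta> ^ Suc m * sgn z)
      = V' (letter_of (d (Suc m))) (d m) (sgn \<beta> ^ Suc m * sgn z)"
  shows "\<exists>\<omega>\<in>subshift \<sigma>. minimal_sequence (z *s \<Gamma>) \<omega> \<and>
    (\<exists>k. prefix_suffix_decomposition \<sigma> (shift k \<omega>) d)"
proof -
  have \<tau>: "cmod (sgn z) = 1" using good by (simp add: good_direction_def)
  have dl: "\<sigma> (letter_of (d (Suc m))) = prefix_of (d m) @ letter_of (d m) # suffix_of (d m)" for m
    using d[of m] by (simp add: labels_at_iff)
  note no_const = not_eventually_constant[OF prim \<Gamma> urp irr \<tau> d opt]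
  obtain a0 b0 where
    first: "\<And>c m0 m. (\<And>m. m \<ge> m0 \<Longrightarrow> c m = hd (\<sigma> (c (Suc m)))) \<Longrightarrow> (m::nat) \<ge> m0 \<Longrightarrow> c m = a0" and
    last: "\<And>c m0 m. (\<And>m. m \<ge> m0 \<Longrightarrow> c m = last (\<sigma> (c (Suc m)))) \<Longrightarrow> (m::nat) \<ge> m0 \<Longrightarrow> c m = b0"
    by (rule iem_letters_eventually_constant[OF iem nonerasing], blast)
  have p: "\<exists>n\<ge>m. prefix_of (d n) \<noteq> []" for m
  proof (rule ccontr)
    assume "\<not> ?thesis"
    then have e: "prefix_of (d n) = []" if "n \<ge> m" for n using that by blast
    have "letter_of (d n) = a0" if "n \<ge> m" for n
    proof (rule first[where c = "\<lambda>n. letter_of (d n)", OF _ that])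
      show "letter_of (d n) = hd (\<sigma> (letter_of (d (Suc n))))" if "n \<ge> m" for n using e[OF that]
        by (simp add: dl)
    qed
    then have "d n = ([], a0, tl (\<sigma> a0))" if "n \<ge> m" for n
      using dl[of n] e[OF that] that by (simp add: prod_eq_iff)
    then show False by (rule no_const)
  qed
  have s: "\<exists>n\<ge>m. suffix_of (d n) \<noteq> []" for m
  proof (rule ccontr)
    assume "\<not> ?thesis"
    then have e: "suffix_of (d n) = []" if "n \<ge> m" for n using that by blast
    have "letter_of (d n) = b0" if "n \<ge> m" for n
    proof (rule last[where c = "\<lambda>n. letter_of (d n)", OF _ that])
      show "letter_of (d n) = List.last (\<sigma> (letter_of (d (Suc n))))" if "n \<ge> m" for n
        using e[OF that] by (simp add: dl)
    qed
    then have "d n = (butlast (\<sigma> b0), b0, [])" if "n \<ge> m" for n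
      using dl[of n] e[OF that] that by (simp add: prod_eq_iff)
    then show False by (rule no_const)
  qed
  obtain \<omega> where \<omega>: "\<And>m.
    map \<omega> [- int (length (left_word \<sigma> d m))..int (length (right_word \<sigma> d m)) - 1]
      = left_word \<sigma> d m @ right_word \<sigma> d m"
    and L: "\<And>k. \<exists>m. k < length (left_word \<sigma> d m)" and R: "\<And>k. \<exists>m. k < length (right_word \<sigma> d m)"
    by (rule two_sided_sequence_with_decomposition[of \<sigma> d, OF nonerasing d p s], blast)
  have mono: "length (left_word \<sigma> d m) \<le> length (left_word \<sigma> d k)"
    "length (right_word \<sigma> d m) \<le> length (right_word \<sigma> d k)" if "m \<le> k" for m k
    by (rule lift_Suc_mono_le[OF _ that], simp add: left_word_simps right_word_simps)+
  have window: "\<exists>k\<ge>m. - int (length (left_word \<sigma> d k)) \<le> i \<and> j < int (length (right_word \<sigma> d k))"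
    for m i j
  proof -
    obtain k1 k2 where k: "nat \<bar>i\<bar> < length (left_word \<sigma> d k1)"
      "nat \<bar>j\<bar> < length (right_word \<sigma> d k2)"
      using L R by blast
    define k where "k = m + k1 + k2"
    have "nat \<bar>i\<bar> < length (left_word \<sigma> d k)" "nat \<bar>j\<bar> < length (right_word \<sigma> d k)"
      using k mono(1)[of k1 k] mono(2)[of k2 k] by (auto simp: k_def)
    then show ?thesis by (intro exI[of _ k]) (auto simp: k_def)
  qed
  have \<omega>_sub: "\<omega> \<in> subshift \<sigma>"
    by (rule decomposition_in_subshift[of d, OF d \<omega>]) (use window in blast)
  obtain m0 where m0: "\<And>n. n \<notin>
    {- int (length (left_word \<sigma> d m0))..<int (length (right_word \<sigma> d m0))} \<Longrightarrow>
    0 \<le> Re (cocycle (z *s \<Gamma>) \<omega> n)"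
    by (rule cocycle_nonnegative_outside_window[of d "sgn z" z \<omega>, OF d opt urp good refl \<omega> window],
      blast)
  have "\<exists>k. minimal_sequence (z *s \<Gamma>) (shift k \<omega>)"
  proof (rule minimal_sequence_shift_of_min)
    show "0 \<le> Re (cocycle (z *s \<Gamma>) \<omega> n)"
      if "n \<notin> {- int (length (left_word \<sigma> d m0))..<int (length (right_word \<sigma> d m0))}" for n
      by (rule m0[OF that])
  qed (simp_all add: right_word_def)
  then obtain k where k: "minimal_sequence (z *s \<Gamma>) (shift k \<omega>)" by blast
  have "prefix_suffix_decomposition \<sigma> (shift (- k) (shift k \<omega>)) d"
    unfolding shift_shift prefix_suffix_decomposition_iff using d \<omega> by blast
  then show ?thesis using k shift_in_subshift[OF \<omega>_sub] by blast
qed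

section \<open>Bijectivity on minimal components\<close>

text \<open>An ordinary point of the split interval has no new point immediately to its right, so right
  neighbourhoods look as they do in the real line.\<close>

lemma split_open_right_neighbourhood:
  assumes "openin (split_topology h) U" and "At t \<in> U"
  shows "\<exists>\<epsilon>>0. \<forall>s. t \<le> s \<and> s < t + \<epsilon> \<and> s < 1 \<longrightarrow> At s \<in> U"
proof -
  have "generate_topology_on
     ({split_interval h} \<union>
      (\<lambda>y. {x \<in> split_interval h. split_less x y}) ` split_interval h \<union>
      (\<lambda>y. {x \<in> split_interval h. split_less y x}) ` split_interval h) U"
    using assms(1) unfolding split_topology_def openin_topology_generated_by_iff .
  then show ?thesis using assms(2)
  proof (induction)
    case Empty
    then show ?case by simp
  next
    case (Int U V)
    then obtain e1 e2 where "e1 > 0" "e2 > 0"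
      "\<forall>s. t \<le> s \<and> s < t + e1 \<and> s < 1 \<longrightarrow> At s \<in> U" "\<forall>s. t \<le> s \<and> s < t + e2 \<and> s < 1 \<longrightarrow> At s \<in> V"
      by blast
    then show ?case by (intro exI[of _ "min e1 e2"]) auto
  next
    case (UN K)
    then show ?case by blast
  next
    case (Basis S)
    have I: "At s \<in> split_interval h \<longleftrightarrow> 0 \<le> s \<and> s < 1" for s by (auto simp: split_interval_def)
    show ?case
    proof (cases "S = split_interval h")
      case True
      with Basis(2) show ?thesis by (intro exI[of _ 1]) (auto simp: I)
    next
      case False
      with Basis(1) obtain y where "S = {x \<in> split_interval h. split_less x y} \<or>
          S = {x \<in> split_interval h. split_less y x}" by blast
      then show ?thesis
      proof
        assume S: "S = {x \<in> split_interval h. split_less x y}"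
        define r where "r = (case y of LeftOf r \<Rightarrow> r | At r \<Rightarrow> r)"
        have "t < r" using Basis(2) by (cases y) (auto simp: S r_def)
        then show ?thesis using Basis(2)
          by (intro exI[of _ "r - t"]) (cases y; auto simp: S I r_def)
      next
        assume S: "S = {x \<in> split_interval h. split_less y x}"
        show ?thesis using Basis(2)
          by (intro exI[of _ 1]) (cases y; auto simp: S I)
      qed
    qed
  qed
qed

lemma bij_betw_to_interval:
  assumes e: "bij_betw e (labels \<sigma>) {..<card (labels \<sigma>)}" and fin: "finite (labels \<sigma>)"
    and ne: "labels \<sigma> \<noteq> {}"
  shows "bij_betw (to_interval \<sigma> e) (states \<sigma>) {0..<1}"
proof -
  define N where "N = card (labels \<sigma>)"
  have N: "N > 0" using fin ne by (simp add: N_def card_gt_0_iff)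
  have fr: "0 \<le> Arg2pi x / (2 * pi)" "Arg2pi x / (2 * pi) < 1" for x
    using Arg2pi[of x] by auto
  have fl: "\<lfloor>real N * to_interval \<sigma> e x\<rfloor> = int (e (snd x))" for x
    using fr[of "fst x"] N by (simp add: to_interval_def N_def[symmetric] floor_unique)
  have inj: "inj_on (to_interval \<sigma> e) (states \<sigma>)"
  proof (rule inj_onI)
    fix x y assume x: "x \<in> states \<sigma>" and y: "y \<in> states \<sigma>"
      and eq: "to_interval \<sigma> e x = to_interval \<sigma> e y"
    have "e (snd x) = e (snd y)" using fl[of x] fl[of y] eq by simp
    moreover have "snd x \<in> labels \<sigma>" "snd y \<in> labels \<sigma>" using x y by (auto simp: states_def)
    ultimately have s: "snd x = snd y" using e by (meson bij_betw_imp_inj_on inj_onD)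
    with eq N have "Arg2pi (fst x) = Arg2pi (fst y)" by (simp add: to_interval_def N_def[symmetric])
    moreover have "cmod (fst x) = 1" "cmod (fst y) = 1" using x y by (auto simp: states_def)
    ultimately have "fst x = fst y" by (metis complex_norm_eq_1_exp)
    with s show "x = y" by (simp add: prod_eq_iff)
  qed
  have "to_interval \<sigma> e x \<in> {0..<1}" if "x \<in> states \<sigma>" for x
  proof -
    have "e (snd x) < N" using that e by (auto simp: states_def N_def bij_betw_def)
    then have "real (e (snd x)) + 1 \<le> real N" by linarith
    then have "real (e (snd x)) + Arg2pi (fst x) / (2 * pi) < real N" using fr(2)[of "fst x"]
      by linarith
    then show ?thesis using fr(1)[of "fst x"] N by (simp add: to_interval_def N_def[symmetric])
  qed
  moreover have "t \<in> to_interval \<sigma> e ` states \<sigma>" if t: "t \<in> {0..<1}" for t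
  proof -
    define k where "k = nat \<lfloor>real N * t\<rfloor>"
    define f where "f = frac (real N * t)"
    have tk: "real N * t = real k + f" using t by (simp add: k_def f_def frac_def)
    have f: "0 \<le> f" "f < 1" by (simp_all add: f_def frac_lt_1)
    have "real N * t < real N" using t N by simp
    then have "k < N" using tk f by linarith
    then have "k \<in> e ` labels \<sigma>" using e by (simp add: N_def bij_betw_def)
    then obtain l where l: "l \<in> labels \<sigma>" "e l = k" by blast
    have "2 * pi * f < 2 * pi" using f by simp
    then have "Arg2pi (cis (2 * pi * f)) = 2 * pi * f"
      using f by (intro Arg2pi_unique[of 1]) (auto simp: cis_conv_exp)
    then have "to_interval \<sigma> e (cis (2 * pi * f), l) = t"
      using N tk by (simp add: to_interval_def N_def[symmetric] l field_simps)
    moreover have "(cis (2 * pi * f), l) \<in> states \<sigma>" using l by (simp add: states_def)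
    ultimately show ?thesis by (metis image_eqI)
  qed
  ultimately show ?thesis using inj by (auto simp: bij_betw_def)
qed

lemma to_interval_right_neighbourhood:
  assumes x: "cmod x = 1" and \<epsilon>: "\<epsilon> > 0" and fin: "finite (labels \<sigma>)" and ne: "labels \<sigma> \<noteq> {}"
  shows "\<exists>\<eta>>0. \<forall>\<theta>. 0 \<le> \<theta> \<and> \<theta> < \<eta> \<longrightarrow>
    to_interval \<sigma> e (x, l) \<le> to_interval \<sigma> e (x * cis \<theta>, l) \<and>
    to_interval \<sigma> e (x * cis \<theta>, l) < to_interval \<sigma> e (x, l) + \<epsilon>"
proof -
  define N where "N = real (card (labels \<sigma>))"
  have N: "N > 0" using fin ne by (simp add: N_def card_gt_0_iff)
  define \<eta> where "\<eta> = min (2 * pi - Arg2pi x) (\<epsilon> * (2 * pi) * N)"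
  have \<eta>: "\<eta> > 0" using \<epsilon> N Arg2pi[of x] by (simp add: \<eta>_def)
  have ti: "to_interval \<sigma> e (x * cis \<theta>, l) = to_interval \<sigma> e (x, l) + \<theta> / (2 * pi) / N"
    if \<theta>: "0 \<le> \<theta>" "\<theta> < \<eta>" for \<theta>
  proof -
    have "exp (\<i> * of_real (Arg2pi x)) = x" using x complex_norm_eq_1_exp by blast
    then have "x * cis \<theta> = exp (\<i> * of_real (Arg2pi x + \<theta>))"
      by (simp add: cis_conv_exp exp_add distrib_left)
    then have "Arg2pi (x * cis \<theta>) = Arg2pi x + \<theta>"
      using \<theta> Arg2pi[of x] by (intro Arg2pi_unique[of 1]) (auto simp: \<eta>_def)
    then show ?thesis by (simp add: to_interval_def N_def[symmetric] add_divide_distrib)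
  qed
  have "\<theta> / (2 * pi) / N < \<epsilon>" if "\<theta> < \<eta>" for \<theta>
    using that N by (simp add: \<eta>_def field_simps)
  then show ?thesis using \<eta> N by (intro exI[of _ \<eta>]) (auto simp: ti)
qed

text \<open>The circle of each label is laid out counterclockwise, so approach from the right on the
  circle is approach from the right in the split interval, where the component is closed.\<close>

lemma minimal_component_right_closed:
  assumes J: "minimal_component \<sigma> e H J"
    and e: "bij_betw e (labels \<sigma>) {..<card (labels \<sigma>)}"
    and fin: "finite (labels \<sigma>)" and ne: "labels \<sigma> \<noteq> {}"
    and x: "cmod x = 1"
  shows "\<exists>\<eta>>0. \<forall>\<theta>. 0 \<le> \<theta> \<and> \<theta> < \<eta> \<longrightarrow> (\<forall>l. (x * cis \<theta>, l) \<in> J \<longrightarrow> (x, l) \<in> J)"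
proof -
  obtain K where K: "split_minimal_component (interval_map \<sigma> e H) K"
    and JK: "J = {x \<in> states \<sigma>. At (to_interval \<sigma> e x) \<in> K}"
    using J by (auto simp: minimal_component_def)
  define X where "X = split_topology (interval_map \<sigma> e H)"
  note bij = bij_betw_to_interval[OF e fin ne]
  have rng: "to_interval \<sigma> e y \<in> {0..<1}" if "y \<in> states \<sigma>" for y
    using bij that by (auto simp: bij_betw_def)
  have cl: "closedin X K" using K by (simp add: split_minimal_component_def X_def)
  then have op: "openin X (topspace X - K)" by blast
  have top: "topspace X = split_interval (interval_map \<sigma> e H)"
    unfolding X_def split_topology_def topology_generated_by_topspace by auto
  have "\<exists>\<eta>>0. \<forall>\<theta>. 0 \<le> \<theta> \<and> \<theta> < \<eta> \<longrightarrow> (x * cis \<theta>, l) \<in> J \<longrightarrow> (x, l) \<in> J" if l: "l \<in> labels \<sigma>" for l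
  proof (cases "(x, l) \<in> J")
    case True
    then show ?thesis by (intro exI[of _ 1]) auto
  next
    case False
    have st: "(x * cis \<theta>, l) \<in> states \<sigma>" for \<theta> using x l by (simp add: states_def norm_mult)
    have st0: "(x, l) \<in> states \<sigma>" using st[of 0] by simp
    with False have "At (to_interval \<sigma> e (x, l)) \<in> topspace X - K"
      using rng[OF st0] by (auto simp: JK top split_interval_def)
    then obtain \<epsilon> where \<epsilon>: "\<epsilon> > 0" "\<forall>s. to_interval \<sigma> e (x, l) \<le> s \<and>
      s < to_interval \<sigma> e (x, l) + \<epsilon> \<and> s < 1
        \<longrightarrow> At s \<in> topspace X - K"
      using split_open_right_neighbourhood[OF op[unfolded X_def]] unfolding X_def by blast
    obtain \<eta> where \<eta>: "\<eta> > 0" "\<forall>\<theta>. 0 \<le> \<theta> \<and> \<theta> < \<eta> \<longrightarrow>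
        to_interval \<sigma> e (x, l) \<le> to_interval \<sigma> e (x * cis \<theta>, l) \<and>
        to_interval \<sigma> e (x * cis \<theta>, l) < to_interval \<sigma> e (x, l) + \<epsilon>"
      using to_interval_right_neighbourhood[OF x \<epsilon>(1) fin ne] by blast
    have "(x * cis \<theta>, l) \<notin> J" if "0 \<le> \<theta>" "\<theta> < \<eta>" for \<theta>
      using \<eta>(2) \<epsilon>(2) that rng[OF st[of \<theta>]] by (auto simp: JK)
    then show ?thesis using \<eta>(1) by blast
  qed
  then obtain \<eta> where \<eta>: "\<And>l. l \<in> labels \<sigma> \<Longrightarrow> \<eta> l > 0 \<and>
      (\<forall>\<theta>. 0 \<le> \<theta> \<and> \<theta> < \<eta> l \<longrightarrow> (x * cis \<theta>, l) \<in> J \<longrightarrow> (x, l) \<in> J)"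
    by metis
  define m where "m = Min (\<eta> ` labels \<sigma>)"
  have "m > 0" using \<eta> fin ne by (auto simp: m_def)
  moreover have "m \<le> \<eta> l" if "l \<in> labels \<sigma>" for l using that fin by (auto simp: m_def)
  moreover have "l \<in> labels \<sigma>" if "(y, l) \<in> J" for y l using that by (auto simp: JK states_def)
  ultimately show ?thesis using \<eta> by (intro exI[of _ m]) (meson less_le_trans)
qed

text \<open>Surjectivity on the split interval is given; the point is that an ordinary point of the
  component also has an ordinary preimage. A new point \<open>LeftOf t\<close> with \<open>t\<close> a cut point has a new
  point as its image, so only \<open>LeftOf 1\<close> could have an ordinary image, and only if 1 is not a cut
  point. In that case \<open>LeftOf 1\<close> itself lacks a preimage in the component.\<close>

lemma minimal_component_invariant:
  assumes J: "minimal_component \<sigma> e H J"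
    and e: "bij_betw e (labels \<sigma>) {..<card (labels \<sigma>)}"
    and fin: "finite (labels \<sigma>)" and ne: "labels \<sigma> \<noteq> {}"
    and H: "H ` states \<sigma> \<subseteq> states \<sigma>"
  shows "J \<subseteq> states \<sigma>" and "H ` J = J"
proof -
  define h where "h = interval_map \<sigma> e H"
  obtain K where K: "split_minimal_component h K"
    and JK: "J = {x \<in> states \<sigma>. At (to_interval \<sigma> e x) \<in> K}"
    using J by (auto simp: minimal_component_def h_def)
  show Js: "J \<subseteq> states \<sigma>" by (auto simp: JK)
  note bij = bij_betw_to_interval[OF e fin ne]
  have inj: "inj_on (to_interval \<sigma> e) (states \<sigma>)" using bij by (simp add: bij_betw_def)
  have h: "h (to_interval \<sigma> e x) = to_interval \<sigma> e (H x)" if "x \<in> states \<sigma>" for x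
    using that inj by (simp add: h_def interval_map_def the_inv_into_f_f)
  have KK: "split_map h ` K = K" using K by (simp add: split_minimal_component_def)
  have sub: "K \<subseteq> split_interval h"
    using K closedin_subset unfolding split_minimal_component_def split_topology_def
      topology_generated_by_topspace by fastforce
  have no_left: "s \<in> cut_points h \<or> s = 1" if "LeftOf s \<in> K" for s
    using sub that by (auto simp: split_interval_def)
  show "H ` J = J"
  proof (intro equalityI subsetI)
    fix y assume "y \<in> H ` J"
    then obtain x where x: "x \<in> J" "y = H x" by blast
    then have "x \<in> states \<sigma>" using Js by blast
    moreover have "At (to_interval \<sigma> e x) \<in> K" using x by (simp add: JK)
    then have "split_map h (At (to_interval \<sigma> e x)) \<in> K" using KK by blast
    ultimately show "y \<in> J" using x H by (auto simp: JK h)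
  next
    fix y assume y: "y \<in> J"
    then have "At (to_interval \<sigma> e y) \<in> split_map h ` K" using KK by (auto simp: JK)
    then obtain q where q: "q \<in> K" "split_map h q = At (to_interval \<sigma> e y)" by auto
    show "y \<in> H ` J"
    proof (cases q)
      case (At t)
      then have t: "t \<in> {0..<1}" using q(1) sub by (auto simp: split_interval_def)
      then have "t \<in> to_interval \<sigma> e ` states \<sigma>" using bij by (simp add: bij_betw_def)
      then obtain x where x: "x \<in> states \<sigma>" "t = to_interval \<sigma> e x" by blast
      then have "to_interval \<sigma> e (H x) = to_interval \<sigma> e y" using q(2) At h by simp
      then have "H x = y" using inj x(1) H y Js by (meson image_subset_iff inj_onD subsetD)
      moreover have "x \<in> J" using x q(1) At by (simp add: JK)
      ultimately show ?thesis by blast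
    next
      case (LeftOf t)
      then have nc: "left_version h t \<notin> cut_points h \<union> {1}" using q(2) by (auto split: if_splits)
      then have "t \<notin> cut_points h" using cut_points.image by blast
      then have t1: "t = 1" using no_left q(1) LeftOf by blast
      have "LeftOf t \<in> split_map h ` K" using q(1) LeftOf KK by simp
      then obtain q' where q': "q' \<in> K" "split_map h q' = LeftOf 1" using t1 by auto
      then obtain s where s: "q' = LeftOf s" "left_version h s = 1"
        by (cases q') (auto split: if_splits)
      then have "s \<noteq> 1" using nc t1 by auto
      then have "s \<in> cut_points h" using no_left q'(1) s(1) by blast
      then have "left_version h s \<in> cut_points h" by (rule cut_points.image)
      then show ?thesis using s(2) t1 \<open>t \<notin> cut_points h\<close> by simp
    qed
  qed
qed

text \<open>The counting argument for a finite-to-one extension of an irrational rotation: the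
  cardinality of the fibres is monotone along orbits and upper semicontinuous from the right,
  hence constant.\<close>

lemma bij_betw_skew_product:
  fixes H :: "complex \<times> 'b \<Rightarrow> complex \<times> 'b"
  assumes w: "cmod w = 1" "\<forall>n\<ge>1. w ^ n \<noteq> 1"
    and JL: "J \<subseteq> sphere 0 1 \<times> \<Lambda>" and fin: "finite \<Lambda>"
    and HJ: "H ` J = J" and fst: "\<And>x. x \<in> J \<Longrightarrow> w * fst (H x) = fst x"
    and right: "\<And>x. cmod x = 1 \<Longrightarrow>
      \<exists>\<eta>>0. \<forall>\<theta>. 0 \<le> \<theta> \<and> \<theta> < \<eta> \<longrightarrow> (\<forall>l. (x * cis \<theta>, l) \<in> J \<longrightarrow> (x, l) \<in> J)"
  shows "bij_betw H J J"
proof -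
  define A where "A x = {l. (x, l) \<in> J}" for x
  have finA: "finite (A x)" for x using JL by (auto simp: A_def intro: finite_subset[OF _ fin])
  have w0: "w \<noteq> 0" using w by auto
  have fib: "A x = (\<lambda>l. snd (H (w * x, l))) ` A (w * x)" for x
  proof (intro equalityI subsetI)
    fix l assume "l \<in> A x"
    then have "(x, l) \<in> H ` J" using HJ by (simp add: A_def)
    then obtain y where y: "y \<in> J" "H y = (x, l)" by auto
    then have "fst y = w * x" using fst[OF y(1)] by simp
    then have "y = (w * x, snd y)" by (simp add: prod_eq_iff)
    then show "l \<in> (\<lambda>l. snd (H (w * x, l))) ` A (w * x)"
      using y by (intro image_eqI[of _ _ "snd y"]) (auto simp: A_def dest: sym)
  next
    fix l assume "l \<in> (\<lambda>l. snd (H (w * x, l))) ` A (w * x)"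
    then obtain k where k: "(w * x, k) \<in> J" "l = snd (H (w * x, k))" by (auto simp: A_def)
    then have "fst (H (w * x, k)) = x" using fst[OF k(1)] w0 by simp
    then have "H (w * x, k) = (x, l)" using k by (simp add: prod_eq_iff)
    then show "l \<in> A x" using HJ k(1) by (metis A_def imageI mem_Collect_eq)
  qed
  have step: "card (A x) \<le> card (A (w * x))" for x
    by (subst fib) (rule card_image_le[OF finA])
  have step': "card (A x) \<le> card (A (w ^ n * x))" for n x
  proof (induction n)
    case (Suc n)
    then show ?case using step[of "w ^ n * x"] by (simp add: mult.assoc)
  qed simp
  have le: "card (A y) \<le> card (A x)" if x: "cmod x = 1" and y: "cmod y = 1" for x y
  proof -
    obtain \<eta> where \<eta>: "\<eta> > 0" "\<forall>\<theta>. 0 \<le> \<theta> \<and> \<theta> < \<eta> \<longrightarrow> (\<forall>l. (x * cis \<theta>, l) \<in> J \<longrightarrow> (x, l) \<in> J)"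
      using right[OF x] by blast
    obtain n \<theta> where n: "0 < \<theta>" "\<theta> < \<eta>" "w ^ n * y = x * cis \<theta>"
      using rotation_orbit_dense_from_right[OF w y x \<eta>(1)] .
    have "A (w ^ n * y) \<subseteq> A x"
      using \<eta>(2)[rule_format, of \<theta>] n(1,2) by (simp add: A_def n(3) subset_iff)
    then have "card (A (w ^ n * y)) \<le> card (A x)" by (intro card_mono finA)
    with step'[of y n] show ?thesis by linarith
  qed
  have "inj_on H J"
  proof (rule inj_onI)
    fix u v assume u: "u \<in> J" and v: "v \<in> J" and eq: "H u = H v"
    define x where "x = fst (H u)"
    have fu: "fst u = w * x" and fv: "fst v = w * x" using fst[OF u] fst[OF v] eq
      by (auto simp: x_def)
    have "cmod (fst u) = 1" using JL u by auto
    moreover then have "cmod x = 1" using w(1) fu by (simp add: norm_mult)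
    ultimately have "card (A (w * x)) = card (A x)" using le fu by (metis order_antisym)
    then have "inj_on (\<lambda>l. snd (H (w * x, l))) (A (w * x))"
      by (intro eq_card_imp_inj_on finA) (simp flip: fib)
    moreover have "snd u \<in> A (w * x)" "snd v \<in> A (w * x)"
      using u v fu fv by (auto simp: A_def simp flip: fu) (metis fv fu prod.collapse)
    ultimately have "snd u = snd v"
      using eq fu fv by (metis (mono_tags, lifting) inj_onD prod.collapse)
    then show "u = v" using fu fv by (simp add: prod_eq_iff)
  qed
  then show ?thesis using HJ by (simp add: bij_betw_def)
qed

text \<open>\<open>H\<close> covers the rotation by \<open>(sgn \<beta>)\<^sup>-\<^sup>1\<close>, so \<open>bij_betw_skew_product\<close> applies with \<open>w = sgn
  \<beta>\<close>, which undoes one step of \<open>H\<close> on the circle.\<close>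

lemma (in expanding_substitution) H_bij_betw_minimal_component:
  assumes H: "is_H_map \<sigma> \<beta> \<Gamma> H" and e: "bij_betw e (labels \<sigma>) {..<card (labels \<sigma>)}"
    and J: "minimal_component \<sigma> e H J" and irr: "\<forall>n\<ge>1. sgn \<beta> ^ n \<noteq> 1"
  shows "J \<subseteq> states \<sigma>" and "bij_betw H J J"
proof -
  have H_st: "H x \<in> states \<sigma> \<and> sgn \<beta> * fst (H x) = fst x" if x: "x \<in> states \<sigma>" for x
  proof -
    obtain t q a r where x': "x = (t, (q, a, r))" by (metis prod.collapse)
    then obtain l where l: "l \<in> labels_at \<sigma> a" "H x = (inverse (sgn \<beta>) * t, l)"
      using H x unfolding is_H_map_def by blast
    have "sgn \<beta> \<noteq> 0" using \<beta>_nz by (simp add: sgn_zero_iff)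
    then show ?thesis using x x' l labels_at_subset[of \<sigma> a] sgn_\<beta>
      by (auto simp: states_def norm_mult norm_inverse)
  qed
  then have "H ` states \<sigma> \<subseteq> states \<sigma>" by blast
  note inv = minimal_component_invariant[OF J e finite_labels labels_nonempty this]
  show "J \<subseteq> states \<sigma>" by (rule inv(1))
  show "bij_betw H J J"
  proof (rule bij_betw_skew_product[OF sgn_\<beta> irr _ finite_labels inv(2)])
    show "J \<subseteq> sphere 0 1 \<times> labels \<sigma>" using inv(1) by (simp add: states_def)
    show "sgn \<beta> * fst (H x) = fst x" if "x \<in> J" for x using that inv(1) H_st by blast
    show "\<exists>\<eta>>0. \<forall>\<theta>. 0 \<le> \<theta> \<and> \<theta> < \<eta> \<longrightarrow> (\<forall>l. (x * cis \<theta>, l) \<in> J \<longrightarrow> (x, l) \<in> J)"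
      if "cmod x = 1" for x
      by (rule minimal_component_right_closed[OF J e finite_labels labels_nonempty that])
  qed
qed

section \<open>Labels along the inverse orbit\<close>

theorem theorem3p4:
  fixes T :: "real \<Rightarrow> real" and P :: "'a::finite \<Rightarrow> real set" and \<delta> :: "real^'a" and \<alpha> :: real
    and \<sigma> :: "'a \<Rightarrow> 'a list" and \<beta> z \<tau> :: complex and \<Gamma> \<gamma> :: "complex^'a"
    and H :: "complex \<times> 'a label \<Rightarrow> complex \<times> 'a label" and e :: "'a label \<Rightarrow> nat"
    and J :: "(complex \<times> 'a label) set" and p\<^sub>0 s\<^sub>0 :: "'a list" and c\<^sub>0 :: 'a
  assumes "is_iem T P \<delta>" and "iem_minimal T" and "self_similar T \<alpha>"
    and "associated_substitution T P \<alpha> \<sigma>" and "primitive_subst \<sigma>"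
    and "cmod \<beta> > 1" and "\<forall>n\<ge>1. sgn \<beta> ^ n \<noteq> 1"
    and "is_eigenvector (subst_matrix \<sigma>) \<beta> \<Gamma>"
    and "unique_representation \<sigma> \<beta> \<Gamma>"
    and "good_eigenvector \<sigma> \<beta> \<Gamma> \<gamma>" and "\<gamma> = z *s \<Gamma>" and "\<tau> = sgn z"
    and "is_H_map \<sigma> \<beta> \<Gamma> H"
    and "bij_betw e (labels \<sigma>) {..<card (labels \<sigma>)}"
    and "minimal_component \<sigma> e H J"
    and "(\<tau>, (p\<^sub>0, c\<^sub>0, s\<^sub>0)) \<in> J"
  shows "\<exists>p c s.
    (\<forall>m. (the_inv_into J H ^^ m) (\<tau>, (p\<^sub>0, c\<^sub>0, s\<^sub>0)) = (sgn \<beta> ^ m * \<tau>, (p m, c m, s m))) \<and>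
    (\<exists>\<omega>\<in>subshift \<sigma>. minimal_sequence \<gamma> \<omega> \<and>
       (\<exists>k. prefix_suffix_decomposition \<sigma> (shift k \<omega>) (\<lambda>m. (p m, c m, s m))))"
proof -
  interpret expanding_substitution \<sigma> \<beta> \<Gamma>
    by unfold_locales (use assms(5,6,8) in
      \<open>simp_all add: primitive_nonerasing eigenvector_word_value\<close>)
  have \<Gamma>: "\<Gamma> \<noteq> 0" using assms(8) by (simp add: is_eigenvector_def)
  have good: "good_direction \<sigma> \<beta> \<Gamma> (sgn z)"
  proof -
    obtain w where w: "\<gamma> = w *s \<Gamma>" "good_direction \<sigma> \<beta> \<Gamma> (sgn w)"
      using assms(10) by (auto simp: good_eigenvector_def)
    then have "z *s \<Gamma> = w *s \<Gamma>" using assms(11) by simp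
    then have "z = w" using \<Gamma> by (simp add: vector_mul_rcancel)
    then show ?thesis using w(2) by simp
  qed
  note JH = H_bij_betw_minimal_component[OF assms(13,14,15,7)]
  define x where "x m = (the_inv_into J H ^^ m) (\<tau>, (p\<^sub>0, c\<^sub>0, s\<^sub>0))" for m
  have inj: "inj_on H J" and surj: "H ` J = J" using JH(2) by (auto simp: bij_betw_def)
  have xJ: "x m \<in> J" for m
  proof (induction m)
    case (Suc m)
    then show ?case using the_inv_into_into[OF inj, of "x m" J] surj by (simp add: x_def)
  qed (simp add: x_def assms(16))
  have Hx: "H (x (Suc m)) = x m" for m
    using f_the_inv_into_f[OF inj, of "x m"] xJ surj by (simp add: x_def)
  define d where "d m = snd (x m)" for m
  have step: "d m \<in> labels_at \<sigma> (letter_of (d (Suc m))) \<and> fst (x (Suc m)) = sgn \<beta> * fst (x m) \<and>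
      V (letter_of (d (Suc m))) (fst (x (Suc m))) = V' (letter_of (d (Suc m))) (d m)
        (fst (x (Suc m)))" for m
  proof -
    obtain t q a r where x': "x (Suc m) = (t, (q, a, r))" by (metis prod.collapse)
    have "(t, (q, a, r)) \<in> states \<sigma>" using xJ[of "Suc m"] JH(1) x' by auto
    then obtain l where l: "l \<in> labels_at \<sigma> a" "V a t = V' a l t"
      "H (t, (q, a, r)) = (inverse (sgn \<beta>) * t, l)"
      using assms(13) unfolding is_H_map_def by blast
    have "x m = (inverse (sgn \<beta>) * t, l)" using l(3) Hx[of m] x' by simp
    moreover have "sgn \<beta> \<noteq> 0" using \<beta>_nz by (simp add: sgn_zero_iff)
    ultimately show ?thesis using l x' by (simp add: d_def)
  qed
  have fst_x: "fst (x m) = sgn \<beta> ^ m * sgn z" for m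
  proof (induction m)
    case 0
    then show ?case by (simp add: x_def assms(12))
  next
    case (Suc m)
    then show ?case using step[of m] by (simp add: mult.assoc)
  qed
  have "x m = (sgn \<beta> ^ m * \<tau>, (prefix_of (d m), letter_of (d m), suffix_of (d m)))" for m
    using fst_x[of m] by (simp add: prod_eq_iff d_def assms(12))
  moreover have "\<exists>\<omega>\<in>subshift \<sigma>. minimal_sequence (z *s \<Gamma>) \<omega> \<and>
    (\<exists>k. prefix_suffix_decomposition \<sigma> (shift k \<omega>) d)"
    using step fst_x
    by (intro minimal_sequence_of_optimal_labels[OF assms(1,3,4,5) \<Gamma> assms(7,9) good]) metis+
  ultimately show ?thesis
    unfolding x_def assms(11)
    by (intro exI[of _ "\<lambda>m. prefix_of (d m)"] exI[of _ "\<lambda>m. letter_of (d m)"]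
      exI[of _ "\<lambda>m. suffix_of (d m)"]) simp
qed

end
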